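(* Let $(M,g)$ be a $3$-dimensional Riemannian manifold, let $CY$ be its Cotton–York tensor and let $p\in M$. The following are equivalent: (a) there is a nonzero tangent vector $v\in T_pM$ such that $CY_p(v,v)=0$ and $CY_p(w_1,w_2)=0$ for every pair of vectors $w_1,w_2\in v^\perp$; (b) $\det(CY_p)=0$, where the determinant is that of the matrix of $CY_p$ in any basis of $T_pM$.
   Context: In dimension $3$ the Schouten tensor is $S=\mathrm{Ric}-\frac{s}{4}g$ ($s$ the scalar curvature), the Cotton tensor is $C_{ijk}=(\nabla_iS)_{jk}-(\nabla_jS)_{ik}$, and the Cotton–York tensor is the $(0,2)$ tensor given in local oriented coordinates by $$CY_{ij}=\tfrac12\, C_{kli}\,g_{jm}\,\frac{\epsilon^{klm}}{\sqrt{\det g}}$$ (summation over repeated indices), where $\epsilon^{klm}\in\{0,1,-1\}$ is the signature of $(k,l,m)$. It is symmetric and trace-free with respect to $g$; changing the local orientation changes its sign. $v^\perp\subset T_pM$ denotes the $g$-orthogonal complement of $v$. *)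

theory Defs
  imports "HOL-Analysis.Analysis" "HOL-Library.Function_Algebras"
begin

text \<open>Pointwise scalar multiplication, extending the pointwise addition of
  \<open>Function_Algebras\<close>; tangent vectors below are functions on the atlas.\<close>

instantiation "fun" :: (type, real_vector) real_vector
begin

definition scaleR_fun :: "real \<Rightarrow> ('a \<Rightarrow> 'b) \<Rightarrow> 'a \<Rightarrow> 'b"
  where "scaleR_fun a f = (\<lambda>x. a *\<^sub>R f x)"

instance
  by standard (auto simp: scaleR_fun_def plus_fun_def fun_eq_iff algebra_simps)

end

subsection \<open>Smooth functions on open subsets of Euclidean space\<close>

definition partial :: "'n::finite \<Rightarrow> (real ^ 'n \<Rightarrow> 'b::real_normed_vector) \<Rightarrow> real ^ 'n \<Rightarrow> 'b"
  where "partial i f x = frechet_derivative f (at x) (axis i 1)"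

text \<open>\<open>Ck_on k U f\<close>: \<open>f\<close> is of class \<open>C\<^sup>k\<close> on the open set \<open>U\<close>.\<close>

primrec Ck_on :: "nat \<Rightarrow> (real ^ 'n::finite) set \<Rightarrow> (real ^ 'n \<Rightarrow> 'b::real_normed_vector) \<Rightarrow> bool"
  where
    "Ck_on 0 U f \<longleftrightarrow> continuous_on U f"
  | "Ck_on (Suc k) U f \<longleftrightarrow> f differentiable_on U \<and> (\<forall>i. Ck_on k U (partial i f))"

definition smooth_on :: "(real ^ 'n::finite) set \<Rightarrow> (real ^ 'n \<Rightarrow> 'b::real_normed_vector) \<Rightarrow> bool"
  where "smooth_on U f \<longleftrightarrow> (\<forall>k. Ck_on k U f)"

subsection \<open>Smooth manifolds\<close>

text \<open>A chart is a pair of its domain and its coordinate map; the values of the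
  coordinate map outside the domain are irrelevant.\<close>

type_synonym ('m, 'n) chart = "'m set \<times> ('m \<Rightarrow> real ^ 'n)"

definition is_chart :: "'m topology \<Rightarrow> ('m, 'n::finite) chart \<Rightarrow> bool"
  where "is_chart X c \<longleftrightarrow>
    openin X (fst c) \<and> open (snd c ` fst c) \<and>
    homeomorphic_map (subtopology X (fst c)) (top_of_set (snd c ` fst c)) (snd c)"

definition chart_inv :: "('m, 'n::finite) chart \<Rightarrow> real ^ 'n \<Rightarrow> 'm"
  where "chart_inv c = inv_into (fst c) (snd c)"

text \<open>The coordinate change from \<open>c\<close> to \<open>d\<close>.\<close>

definition transition :: "('m, 'n::finite) chart \<Rightarrow> ('m, 'n) chart \<Rightarrow> real ^ 'n \<Rightarrow> real ^ 'n"
  where "transition c d = snd d \<circ> chart_inv c"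

text \<open>The atlas is not required to be maximal; maximal atlases are a special case.\<close>

definition smooth_manifold :: "'m topology \<Rightarrow> ('m, 'n::finite) chart set \<Rightarrow> bool"
  where "smooth_manifold X A \<longleftrightarrow>
    Hausdorff_space X \<and> second_countable X \<and>
    (\<forall>c\<in>A. is_chart X c) \<and> (\<Union>c\<in>A. fst c) = topspace X \<and>
    (\<forall>c\<in>A. \<forall>d\<in>A. smooth_on (snd c ` (fst c \<inter> fst d)) (transition c d))"

subsection \<open>Tangent vectors and Riemannian metrics\<close>

text \<open>A tangent vector at \<open>p\<close> assigns to each chart around \<open>p\<close> a component vector,
  the components in different charts being related by the differential of the
  coordinate change. The value at all other arguments is fixed to be 0, so that
  equality of tangent vectors is equality of functions.\<close>

type_synonym ('m, 'n) tangent_vector = "('m, 'n) chart \<Rightarrow> real ^ 'n"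

definition charts_at :: "('m, 'n::finite) chart set \<Rightarrow> 'm \<Rightarrow> ('m, 'n) chart set"
  where "charts_at A p = {c \<in> A. p \<in> fst c}"

definition tangent_space ::
    "('m, 'n::finite) chart set \<Rightarrow> 'm \<Rightarrow> ('m, 'n) tangent_vector set"
  where "tangent_space A p =
    {v. (\<forall>c\<in>charts_at A p. \<forall>d\<in>charts_at A p.
           v d = frechet_derivative (transition c d) (at (snd c p)) (v c)) \<and>
        (\<forall>c. c \<notin> charts_at A p \<longrightarrow> v c = 0)}"

text \<open>The coordinate vector \<open>\<partial>/\<partial>x\<^sup>i\<close> of the chart \<open>c\<close> at \<open>p\<close>.\<close>

definition coord_vector ::
    "('m, 'n::finite) chart set \<Rightarrow> ('m, 'n) chart \<Rightarrow> 'm \<Rightarrow> 'n \<Rightarrow> ('m, 'n) tangent_vector"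
  where "coord_vector A c p i = (\<lambda>d.
    if d \<in> charts_at A p
    then frechet_derivative (transition c d) (at (snd c p)) (axis i 1) else 0)"

definition is_basis_of :: "('n::finite \<Rightarrow> 'v::real_vector) \<Rightarrow> 'v set \<Rightarrow> bool"
  where "is_basis_of b T \<longleftrightarrow> inj b \<and> independent (range b) \<and> span (range b) = T"

type_synonym ('m, 'n) metric_field =
  "'m \<Rightarrow> ('m, 'n) tangent_vector \<Rightarrow> ('m, 'n) tangent_vector \<Rightarrow> real"

definition inner_product_on :: "'v::real_vector set \<Rightarrow> ('v \<Rightarrow> 'v \<Rightarrow> real) \<Rightarrow> bool"
  where "inner_product_on T h \<longleftrightarrow>
    (\<forall>u\<in>T. \<forall>v\<in>T. h u v = h v u) \<and>
    (\<forall>u\<in>T. \<forall>v\<in>T. \<forall>w\<in>T. h (u + v) w = h u w + h v w) \<and>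
    (\<forall>a. \<forall>u\<in>T. \<forall>v\<in>T. h (a *\<^sub>R u) v = a * h u v) \<and>
    (\<forall>v\<in>T. v \<noteq> 0 \<longrightarrow> h v v > 0)"

text \<open>The matrix \<open>g\<^sub>i\<^sub>j\<close> as a function of the coordinates of \<open>c\<close>.\<close>

definition metric_coords ::
    "('m, 'n::finite) chart set \<Rightarrow> ('m, 'n) metric_field \<Rightarrow> ('m, 'n) chart
      \<Rightarrow> real ^ 'n \<Rightarrow> real ^ 'n ^ 'n"
  where "metric_coords A g c x =
    (\<chi> i j. g (chart_inv c x) (coord_vector A c (chart_inv c x) i)
                               (coord_vector A c (chart_inv c x) j))"

definition riemannian_manifold ::
    "'m topology \<Rightarrow> ('m, 'n::finite) chart set \<Rightarrow> ('m, 'n) metric_field \<Rightarrow> bool"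
  where "riemannian_manifold X A g \<longleftrightarrow>
    smooth_manifold X A \<and>
    (\<forall>p\<in>topspace X. inner_product_on (tangent_space A p) (g p)) \<and>
    (\<forall>c\<in>A. smooth_on (snd c ` fst c) (metric_coords A g c))"

definition orthogonal_complement ::
    "('m, 'n::finite) chart set \<Rightarrow> ('m, 'n) metric_field \<Rightarrow> 'm
      \<Rightarrow> ('m, 'n) tangent_vector \<Rightarrow> ('m, 'n) tangent_vector set"
  where "orthogonal_complement A g p v = {w \<in> tangent_space A p. g p v w = 0}"

subsection \<open>Curvature in local coordinates\<close>

text \<open>Throughout, \<open>G\<close> is the matrix \<open>g\<^sub>i\<^sub>j\<close> of a metric as a function of the
  coordinates.\<close>

text \<open>\<open>christoffel G k i j x\<close> is \<open>\<Gamma>\<^sup>k\<^sub>i\<^sub>j\<close>.\<close>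

definition christoffel ::
    "(real ^ 'n \<Rightarrow> real ^ 'n ^ 'n::finite) \<Rightarrow> 'n \<Rightarrow> 'n \<Rightarrow> 'n \<Rightarrow> real ^ 'n \<Rightarrow> real"
  where "christoffel G k i j x = 1/2 * (\<Sum>l\<in>UNIV. matrix_inv (G x) $ k $ l *
    (partial i (\<lambda>y. G y $ j $ l) x + partial j (\<lambda>y. G y $ i $ l) x
      - partial l (\<lambda>y. G y $ i $ j) x))"

text \<open>\<open>riemann G l k i j x\<close> is the coefficient of \<open>\<partial>\<^sub>l\<close> in \<open>R(\<partial>\<^sub>i, \<partial>\<^sub>j)\<partial>\<^sub>k\<close>,
  where \<open>R(X,Y)Z = \<nabla>\<^sub>X\<nabla>\<^sub>YZ - \<nabla>\<^sub>Y\<nabla>\<^sub>XZ - \<nabla>\<^bsub>[X,Y]\<^esub>Z\<close>.\<close>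

definition riemann ::
    "(real ^ 'n \<Rightarrow> real ^ 'n ^ 'n::finite) \<Rightarrow> 'n \<Rightarrow> 'n \<Rightarrow> 'n \<Rightarrow> 'n \<Rightarrow> real ^ 'n \<Rightarrow> real"
  where "riemann G l k i j x =
    partial i (christoffel G l j k) x - partial j (christoffel G l i k) x +
    (\<Sum>m\<in>UNIV. christoffel G l i m x * christoffel G m j k x
               - christoffel G l j m x * christoffel G m i k x)"

definition ricci ::
    "(real ^ 'n \<Rightarrow> real ^ 'n ^ 'n::finite) \<Rightarrow> 'n \<Rightarrow> 'n \<Rightarrow> real ^ 'n \<Rightarrow> real"
  where "ricci G j k x = (\<Sum>i\<in>UNIV. riemann G i k i j x)"

definition scalar_curvature ::
    "(real ^ 'n \<Rightarrow> real ^ 'n ^ 'n::finite) \<Rightarrow> real ^ 'n \<Rightarrow> real"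
  where "scalar_curvature G x =
    (\<Sum>j\<in>UNIV. \<Sum>k\<in>UNIV. matrix_inv (G x) $ j $ k * ricci G j k x)"

definition schouten :: "(real ^ 3 \<Rightarrow> real ^ 3 ^ 3) \<Rightarrow> 3 \<Rightarrow> 3 \<Rightarrow> real ^ 3 \<Rightarrow> real"
  where "schouten G j k x = ricci G j k x - scalar_curvature G x / 4 * G x $ j $ k"

text \<open>\<open>cov_deriv G S i j k x\<close> is \<open>(\<nabla>\<^sub>iS)\<^sub>j\<^sub>k\<close>.\<close>

definition cov_deriv ::
    "(real ^ 'n \<Rightarrow> real ^ 'n ^ 'n::finite) \<Rightarrow> ('n \<Rightarrow> 'n \<Rightarrow> real ^ 'n \<Rightarrow> real)
      \<Rightarrow> 'n \<Rightarrow> 'n \<Rightarrow> 'n \<Rightarrow> real ^ 'n \<Rightarrow> real"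
  where "cov_deriv G S i j k x = partial i (S j k) x
    - (\<Sum>m\<in>UNIV. christoffel G m i j x * S m k x)
    - (\<Sum>m\<in>UNIV. christoffel G m i k x * S j m x)"

definition cotton :: "(real ^ 3 \<Rightarrow> real ^ 3 ^ 3) \<Rightarrow> 3 \<Rightarrow> 3 \<Rightarrow> 3 \<Rightarrow> real ^ 3 \<Rightarrow> real"
  where "cotton G i j k x =
    cov_deriv G (schouten G) i j k x - cov_deriv G (schouten G) j i k x"

text \<open>The elements of the index type \<open>3\<close> are \<open>1\<close>, \<open>2\<close> and \<open>3 = 0\<close>.\<close>

definition levi_civita :: "3 \<Rightarrow> 3 \<Rightarrow> 3 \<Rightarrow> real"
  where "levi_civita k l m =
    (if (k, l, m) \<in> {(1, 2, 3), (2, 3, 1), (3, 1, 2)} then 1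
     else if (k, l, m) \<in> {(1, 3, 2), (3, 2, 1), (2, 1, 3)} then - 1
     else 0)"

definition cotton_york_coords ::
    "(real ^ 3 \<Rightarrow> real ^ 3 ^ 3) \<Rightarrow> 3 \<Rightarrow> 3 \<Rightarrow> real ^ 3 \<Rightarrow> real"
  where "cotton_york_coords G i j x = 1/2 *
    (\<Sum>k\<in>UNIV. \<Sum>l\<in>UNIV. \<Sum>m\<in>UNIV.
      cotton G k l i x * G x $ j $ m * (levi_civita k l m / sqrt (det (G x))))"

text \<open>The Cotton--York tensor at \<open>p\<close> as a bilinear form on the tangent space, for
  the local orientation in which the chart \<open>c\<close> around \<open>p\<close> is oriented. Another
  chart around \<open>p\<close> gives the same form or its negative.\<close>

definition cotton_york ::
    "('m, 3) chart set \<Rightarrow> ('m, 3) metric_field \<Rightarrow> ('m, 3) chart \<Rightarrow> 'm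
      \<Rightarrow> ('m, 3) tangent_vector \<Rightarrow> ('m, 3) tangent_vector \<Rightarrow> real"
  where "cotton_york A g c p v w =
    (\<Sum>i\<in>UNIV. \<Sum>j\<in>UNIV.
      cotton_york_coords (metric_coords A g c) i j (snd c p) * v c $ i * w c $ j)"

end

theory Submission
  imports Defs
begin

text \<open>The contracted second Bianchi identity makes the Cotton tensor trace-free, and the symmetry of
  the Ricci tensor makes its cyclic sum vanish; dualising, the Cotton--York tensor \<open>CY\<close> is symmetric
  and trace-free. The theorem is then linear algebra on the Euclidean space \<open>T\<^sub>pM\<close>. If \<open>v\<close> is as in
  (a), some nonzero \<open>w\<close> in the plane \<open>v\<^sup>\<bottom>\<close> has \<open>CY(v, w) = 0\<close>, and \<open>w\<close> lies in the kernel. Conversely,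
  let \<open>u \<noteq> 0\<close> lie in the kernel. On the plane \<open>u\<^sup>\<bottom>\<close> the form \<open>CY\<close> is trace-free, so it has an
  isotropic vector \<open>v\<close>, and the vector \<open>w\<close> obtained by rotating \<open>v\<close> by a right angle is isotropic
  too; \<open>v\<^sup>\<bottom>\<close> is spanned by \<open>u\<close> and \<open>w\<close>, so \<open>CY\<close> vanishes on it.\<close>

subsection \<open>Calculus of smooth functions\<close>

text \<open>Index notation is avoided as far as possible. With the Christoffel symbols collected in
  matrices \<open>\<Gamma> m\<close>, metric compatibility and the skewness of the curvature are
  equations in a noncommutative ring with transposition, and the second Bianchi identity is
  essentially the Jacobi identity for the operators \<open>\<partial>\<^sub>m + \<Gamma> m\<close>.
  Single entries return only where a contraction pairs a matrix index with a differentiation index.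
  Each identity is proved on a whole open coordinate domain, because the next one arises by
  differentiating it; every product rule needs genuine derivatives, which is what the calculus of
  smooth functions supplies. At \<open>p\<close> a chart turns the tangent space into \<real>^3 with
  two matrices, that of the metric and that of CY, and a change of basis multiplies the determinant
  by a nonzero square.\<close>

lemma partial_unique:
  assumes "(f has_derivative f') (at x)"
  shows "partial i f x = f' (axis i 1)"
  using frechet_derivative_at[OF assms] by (simp add: partial_def)

lemma has_derivative_cong_open:
  assumes "open U" "\<And>y. y \<in> U \<Longrightarrow> f y = g y" "x \<in> U"
  shows "(f has_derivative f') (at x) \<longleftrightarrow> (g has_derivative f') (at x)"
  using assms by (metis has_derivative_transform_within_open)

text \<open>\<open>frechet_derivative\<close> is chosen from the set of all derivatives, and that
  set depends only on the germ of the function, so the choices for \<open>f\<close> and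
  \<open>g\<close> coincide. This rule lets an identity valid on an open set be differentiated on
  both sides.\<close>

lemma partial_cong_open:
  assumes "open U" "\<And>y. y \<in> U \<Longrightarrow> f y = g y" "x \<in> U"
  shows "partial i f x = partial i g x"
  unfolding partial_def frechet_derivative_def
  using has_derivative_cong_open[OF assms] by simp

lemma differentiable_on_cong_open:
  assumes "open U" "\<And>y. y \<in> U \<Longrightarrow> f y = g y"
  shows "f differentiable_on U \<longleftrightarrow> g differentiable_on U"
  using has_derivative_cong_open[OF assms] assms(1)
  by (auto simp: differentiable_on_eq_differentiable_at differentiable_def)

lemma Ck_on_cong:
  assumes "open U" "\<And>x. x \<in> U \<Longrightarrow> f x = g x"
  shows "Ck_on k U f \<longleftrightarrow> Ck_on k U g"
  using assms(2)
proof (induction k arbitrary: f g)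
  case 0
  then show ?case by (simp cong: continuous_on_cong)
next
  case (Suc k)
  have "Ck_on k U (partial i f) \<longleftrightarrow> Ck_on k U (partial i g)" for i
    using partial_cong_open[OF assms(1), of f g] Suc.prems by (intro Suc.IH) blast
  with differentiable_on_cong_open[OF assms(1) Suc.prems] show ?case by simp
qed

lemma Ck_on_Suc_D:
  assumes "open U" "Ck_on (Suc k) U f"
  shows "Ck_on k U f"
  using assms(2)
proof (induction k arbitrary: f)
  case 0
  then show ?case by (simp add: differentiable_imp_continuous_on)
next
  case (Suc k)
  then show ?case by (metis Ck_on.simps(2))
qed

lemma smooth_on_cong:
  assumes "open U" "smooth_on U f" "\<And>x. x \<in> U \<Longrightarrow> f x = g x"
  shows "smooth_on U g"
  using assms Ck_on_cong[of U f g] by (simp add: smooth_on_def)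

lemma smooth_on_iff_partial:
  assumes "open U"
  shows "smooth_on U f \<longleftrightarrow> f differentiable_on U \<and> (\<forall>i. smooth_on U (partial i f))"
  using Ck_on_Suc_D[OF assms] unfolding smooth_on_def by (metis Ck_on.simps(2))

lemma smooth_on_partial: "smooth_on U f \<Longrightarrow> open U \<Longrightarrow> smooth_on U (partial i f)"
  using smooth_on_iff_partial[of U f] by blast

lemma smooth_on_has_derivative:
  assumes "smooth_on U f" "open U" "x \<in> U"
  shows "(f has_derivative frechet_derivative f (at x)) (at x)"
  using assms differentiable_on_eq_differentiable_at frechet_derivative_works smooth_on_iff_partial
  by blast

lemma partial_bounded_linear:
  assumes "bounded_linear L" "(f has_derivative f') (at x)"
  shows "partial i (\<lambda>y. L (f y)) x = L (partial i f x)"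
  using partial_unique[OF bounded_linear.has_derivative[OF assms]] partial_unique[OF assms(2)]
  by simp

lemma Ck_on_Suc_has_derivative:
  assumes "Ck_on (Suc k) U f" "open U" "x \<in> U"
  shows "(f has_derivative frechet_derivative f (at x)) (at x)"
  using assms(1,3) differentiable_on_eq_differentiable_at[OF assms(2), of f] frechet_derivative_works[of f "at x"]
  by simp

text \<open>The induction step of the closure proofs: a partial derivative is usually known only
  through a formula \<open>df i\<close> valid on \<open>U\<close>, and openness carries the
  smoothness class of the formula over to \<open>partial i f\<close>.\<close>

lemma Ck_on_SucI:
  assumes "open U" "\<And>x. x \<in> U \<Longrightarrow> (f has_derivative f' x) (at x)"
    and "\<And>x i. x \<in> U \<Longrightarrow> partial i f x = df i x" "\<And>i. Ck_on k U (df i)"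
  shows "Ck_on (Suc k) U f"
proof -
  have "Ck_on k U (partial i f)" for i
    using Ck_on_cong[OF assms(1), of "partial i f" "df i"] assms(3,4) by blast
  then show ?thesis
    using assms(2) by (auto simp: differentiable_on_eq_differentiable_at[OF assms(1)] differentiable_def)
qed

lemma Ck_on_bounded_linear:
  assumes "open U" "bounded_linear L" "Ck_on k U f"
  shows "Ck_on k U (\<lambda>x. L (f x))"
  using assms(3)
proof (induction k arbitrary: f)
  case 0
  then show ?case
    using assms(2) by (simp add: bounded_linear.continuous_on)
next
  case (Suc k)
  note D = Ck_on_Suc_has_derivative[OF Suc.prems assms(1)]
  show ?case
  proof (rule Ck_on_SucI[OF assms(1) bounded_linear.has_derivative[OF assms(2) D]])
    show "partial i (\<lambda>x. L (f x)) x = L (partial i f x)" if "x \<in> U" for i x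
      using partial_bounded_linear[OF assms(2) D[OF that]] .
  qed (use Suc in auto)
qed

lemma smooth_on_bounded_linear:
  "open U \<Longrightarrow> bounded_linear L \<Longrightarrow> smooth_on U f \<Longrightarrow> smooth_on U (\<lambda>x. L (f x))"
  by (simp add: smooth_on_def Ck_on_bounded_linear)

lemma smooth_on_const [simp]: "smooth_on U (\<lambda>x. c)"
proof -
  have "Ck_on k U (\<lambda>x. c)" for k and c :: 'b
  proof (induction k arbitrary: c)
    case (Suc k)
    have "partial i (\<lambda>x :: real ^ 'a. c) = (\<lambda>x. 0)" for i
      by (rule ext) (simp add: partial_unique[OF has_derivative_const])
    then show ?case using Suc by simp
  qed simp
  then show ?thesis by (simp add: smooth_on_def)
qed

lemma partial_add:
  assumes "(f has_derivative f') (at x)" "(g has_derivative g') (at x)"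
  shows "partial i (\<lambda>y. f y + g y) x = partial i f x + partial i g x"
  using partial_unique[OF has_derivative_add[OF assms]] partial_unique[OF assms(1)]
    partial_unique[OF assms(2)] by simp

lemma Ck_on_add:
  assumes "open U" "Ck_on k U f" "Ck_on k U g"
  shows "Ck_on k U (\<lambda>x. f x + g x)"
  using assms(2,3)
proof (induction k arbitrary: f g)
  case 0
  then show ?case by (simp add: continuous_on_add)
next
  case (Suc k)
  note D = Ck_on_Suc_has_derivative[OF Suc.prems(1) assms(1)]
    Ck_on_Suc_has_derivative[OF Suc.prems(2) assms(1)]
  show ?case
  proof (rule Ck_on_SucI[OF assms(1) has_derivative_add[OF D]])
    show "partial i (\<lambda>x. f x + g x) x = partial i f x + partial i g x" if "x \<in> U" for i x
      using partial_add[OF D(1)[OF that] D(2)[OF that]] .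
  qed (use Suc in auto)
qed

lemma smooth_on_add:
  "open U \<Longrightarrow> smooth_on U f \<Longrightarrow> smooth_on U g \<Longrightarrow> smooth_on U (\<lambda>x. f x + g x)"
  by (simp add: smooth_on_def Ck_on_add)

lemma smooth_on_sum:
  assumes "open U" "\<And>i. i \<in> I \<Longrightarrow> smooth_on U (f i)"
  shows "smooth_on U (\<lambda>x. \<Sum>i\<in>I. f i x)"
  using assms(2)
  by (induction I rule: infinite_finite_induct) (auto intro: smooth_on_add assms)

lemma partial_bilinear:
  assumes "bounded_bilinear B" "(f has_derivative f') (at x)" "(g has_derivative g') (at x)"
  shows "partial i (\<lambda>y. B (f y) (g y)) x = B (f x) (partial i g x) + B (partial i f x) (g x)"
  using partial_unique[OF bounded_bilinear.FDERIV[OF assms]] partial_unique[OF assms(2)]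
    partial_unique[OF assms(3)] by simp

text \<open>An arbitrary bounded bilinear map covers products of reals and products of matrices at
  once.\<close>

lemma Ck_on_bilinear:
  assumes "open U" "bounded_bilinear B" "Ck_on k U f" "Ck_on k U g"
  shows "Ck_on k U (\<lambda>x. B (f x) (g x))"
  using assms(3,4)
proof (induction k arbitrary: f g)
  case 0
  then show ?case
    using bounded_bilinear.continuous_on[OF assms(2)] by auto
next
  case (Suc k)
  note D = Ck_on_Suc_has_derivative[OF Suc.prems(1) assms(1)]
    Ck_on_Suc_has_derivative[OF Suc.prems(2) assms(1)]
  show ?case
  proof (rule Ck_on_SucI[OF assms(1) bounded_bilinear.FDERIV[OF assms(2) D]])
    show "partial i (\<lambda>x. B (f x) (g x)) x = B (f x) (partial i g x) + B (partial i f x) (g x)"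
      if "x \<in> U" for i x
      using partial_bilinear[OF assms(2) D(1)[OF that] D(2)[OF that]] .
    \<comment> \<open>Each term of the product rule keeps one undifferentiated factor, so the
      hypotheses on \<open>f\<close> and \<open>g\<close> have to be weakened from class
      \<open>Suc k\<close> to class \<open>k\<close>.\<close>
    show "Ck_on k U (\<lambda>x. B (f x) (partial i g x) + B (partial i f x) (g x))" for i
      using Suc.prems(1)[THEN Ck_on_Suc_D[OF assms(1)]] Suc.prems(2)[THEN Ck_on_Suc_D[OF assms(1)]] Suc.prems
      by (intro Ck_on_add Suc.IH assms(1)) simp_all
  qed
qed

lemma smooth_on_bilinear:
  "open U \<Longrightarrow> bounded_bilinear B \<Longrightarrow> smooth_on U f \<Longrightarrow> smooth_on U g
    \<Longrightarrow> smooth_on U (\<lambda>x. B (f x) (g x))"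
  by (simp add: smooth_on_def Ck_on_bilinear)

lemma smooth_on_minus: "open U \<Longrightarrow> smooth_on U f \<Longrightarrow> smooth_on U (\<lambda>x. - f x)"
  by (rule smooth_on_bounded_linear[OF _ bounded_linear_minus[OF bounded_linear_ident]])

lemma smooth_on_diff:
  "open U \<Longrightarrow> smooth_on U f \<Longrightarrow> smooth_on U g \<Longrightarrow> smooth_on U (\<lambda>x. f x - g x)"
  using smooth_on_add[OF _ _ smooth_on_minus, of U f g] by simp

lemma smooth_on_mult:
  fixes f g :: "real ^ 'n::finite \<Rightarrow> real"
  shows "open U \<Longrightarrow> smooth_on U f \<Longrightarrow> smooth_on U g \<Longrightarrow> smooth_on U (\<lambda>x. f x * g x)"
  by (rule smooth_on_bilinear[OF _ bounded_bilinear_mult])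

lemma smooth_on_nth: "open U \<Longrightarrow> smooth_on U f \<Longrightarrow> smooth_on U (\<lambda>x. f x $ i)"
  by (rule smooth_on_bounded_linear[OF _ bounded_linear_vec_nth])

lemma partial_nth: "(f has_derivative f') (at x) \<Longrightarrow> partial i (\<lambda>y. f y $ j) x = partial i f x $ j"
  by (rule partial_bounded_linear[OF bounded_linear_vec_nth])

text \<open>A vector is the sum of the images of its components under these inclusions; smoothness
  and differentiability of vector-valued functions thereby reduce to their components.\<close>

lemma bounded_linear_axis: "bounded_linear (axis i :: 'a::real_normed_vector \<Rightarrow> 'a ^ 'n)"
proof (rule bounded_linear_intro[where K = 1])
  fix x y :: 'a and r :: real
  show "axis i (x + y) = (axis i x + axis i y :: 'a ^ 'n)"
    by (simp add: vec_eq_iff axis_def)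
  show "axis i (r *\<^sub>R x) = (r *\<^sub>R axis i x :: 'a ^ 'n)"
    by (simp add: vec_eq_iff axis_def)
  have "(\<Sum>j\<in>UNIV. (norm ((axis i x :: 'a ^ 'n) $ j))\<^sup>2) = (\<Sum>j\<in>UNIV. if j = i then (norm x)\<^sup>2 else 0)"
    by (rule sum.cong) (auto simp: axis_def)
  then show "norm (axis i x :: 'a ^ 'n) \<le> norm x * 1"
    by (simp add: norm_vec_def L2_set_def)
qed

lemma smooth_on_vec_lambda:
  fixes f :: "'n::finite \<Rightarrow> real ^ 'm::finite \<Rightarrow> 'b::real_normed_vector"
  assumes "open U" "\<And>i. smooth_on U (f i)"
  shows "smooth_on U (\<lambda>x. \<chi> i. f i x)"
proof -
  have "(\<chi> i. f i x) = (\<Sum>i\<in>UNIV. axis i (f i x))" for x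
    by (simp add: vec_eq_iff axis_def sum.delta)
  then show ?thesis
    by (simp add: smooth_on_sum smooth_on_bounded_linear[OF assms(1) bounded_linear_axis] assms)
qed

lemma partial_sum:
  assumes "\<And>a. a \<in> I \<Longrightarrow> (f a has_derivative f' a) (at x)"
  shows "partial i (\<lambda>y. \<Sum>a\<in>I. f a y) x = (\<Sum>a\<in>I. partial i (f a) x)"
proof -
  have "partial i (\<lambda>y. \<Sum>a\<in>I. f a y) x = (\<Sum>a\<in>I. f' a (axis i 1))"
    by (rule partial_unique[OF has_derivative_sum[OF assms]])
  also have "\<dots> = (\<Sum>a\<in>I. partial i (f a) x)"
    by (rule sum.cong[OF refl partial_unique[OF assms, symmetric]])
  finally show ?thesis .
qed

lemma partial_diff:
  assumes "(f has_derivative f') (at x)" "(g has_derivative g') (at x)"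
  shows "partial i (\<lambda>y. f y - g y) x = partial i f x - partial i g x"
  using partial_unique[OF has_derivative_diff[OF assms]] partial_unique[OF assms(1)]
    partial_unique[OF assms(2)] by simp

subsection \<open>Symmetry of second partial derivatives\<close>

lemma has_real_derivative_along_axis:
  fixes f :: "real ^ 'n::finite \<Rightarrow> real"
  assumes "(f has_derivative f') (at (x + t *\<^sub>R axis i 1))"
  shows "((\<lambda>t. f (x + t *\<^sub>R axis i 1)) has_real_derivative partial i f (x + t *\<^sub>R axis i 1)) (at t)"
proof -
  have "((\<lambda>t. x + t *\<^sub>R axis i 1) has_derivative (\<lambda>h. h *\<^sub>R axis i 1)) (at t)"
    by (auto intro!: derivative_eq_intros)
  from has_derivative_compose[OF this assms]
  have "((\<lambda>t. f (x + t *\<^sub>R axis i 1)) has_derivative (\<lambda>h. f' (h *\<^sub>R axis i 1))) (at t)" .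
  moreover have "(\<lambda>h. f' (h *\<^sub>R axis i 1)) = (\<lambda>h. h * f' (axis i 1))"
    using assms linear_cmul[OF has_derivative_linear[OF assms]] by auto
  ultimately show ?thesis
    using partial_unique[OF assms, of i] by (simp add: has_field_derivative_def mult_commute_abs)
qed

text \<open>The second difference over a square of side \<open>s\<close> is
  \<open>?phi s - ?phi 0\<close>. One use of the mean value theorem in direction \<open>i\<close>
  and one in direction \<open>j\<close> produce the mixed derivative, while the left-hand side is
  symmetric in \<open>i\<close> and \<open>j\<close>.\<close>

lemma second_difference_mvt:
  fixes f :: "real ^ 'n::finite \<Rightarrow> real"
  assumes "open U" "smooth_on U f" "0 < s"
    and sub: "\<And>a b. 0 \<le> a \<Longrightarrow> a \<le> s \<Longrightarrow> 0 \<le> b \<Longrightarrow> b \<le> s \<Longrightarrow> x + a *\<^sub>R axis i 1 + b *\<^sub>R axis j 1 \<in> U"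
  obtains a b where "0 \<le> a" "a \<le> s" "0 \<le> b" "b \<le> s"
    "f (x + s *\<^sub>R axis i 1 + s *\<^sub>R axis j 1) - f (x + s *\<^sub>R axis i 1) - f (x + s *\<^sub>R axis j 1) + f x
      = s * s * partial j (partial i f) (x + a *\<^sub>R axis i 1 + b *\<^sub>R axis j 1)"
proof -
  define u v where "u = (axis i 1 :: real ^ 'n)" and "v = (axis j 1 :: real ^ 'n)"
  let ?phi = "\<lambda>t. f ((x + s *\<^sub>R v) + t *\<^sub>R u) - f (x + t *\<^sub>R u)"
  have sub': "x + a *\<^sub>R u + b *\<^sub>R v \<in> U" "x + b *\<^sub>R v + a *\<^sub>R u \<in> U" if "0 \<le> a" "a \<le> s" "0 \<le> b" "b \<le> s" for a b
    using sub[OF that] by (simp_all add: u_def v_def add_ac)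
  have "(?phi has_real_derivative
      partial i f ((x + s *\<^sub>R v) + t *\<^sub>R u) - partial i f (x + t *\<^sub>R u)) (at t)"
    if "0 \<le> t" "t \<le> s" for t
    unfolding u_def
    using sub'(2)[of t s] sub'(2)[of t 0] that assms
    by (intro DERIV_diff has_real_derivative_along_axis[OF smooth_on_has_derivative[OF assms(2,1)]])
       (auto simp: u_def)
  from MVT2[OF assms(3) this] obtain a where a: "0 < a" "a < s"
    "?phi s - ?phi 0 = (s - 0) * (partial i f ((x + s *\<^sub>R v) + a *\<^sub>R u) - partial i f (x + a *\<^sub>R u))"
    by blast
  let ?psi = "\<lambda>t. partial i f ((x + a *\<^sub>R u) + t *\<^sub>R v)"
  have "(?psi has_real_derivative partial j (partial i f) ((x + a *\<^sub>R u) + t *\<^sub>R v)) (at t)"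
    if "0 \<le> t" "t \<le> s" for t
    unfolding v_def
    using sub'(1)[of a t] that assms a(1,2)
    by (intro has_real_derivative_along_axis[OF smooth_on_has_derivative[OF smooth_on_partial[OF assms(2,1)] assms(1)]])
       (auto simp: v_def)
  from MVT2[OF assms(3) this] obtain b where b: "0 < b" "b < s"
    "?psi s - ?psi 0 = (s - 0) * partial j (partial i f) ((x + a *\<^sub>R u) + b *\<^sub>R v)"
    by blast
  have "x + s *\<^sub>R v + a *\<^sub>R u = x + a *\<^sub>R u + s *\<^sub>R v" "x + s *\<^sub>R v + s *\<^sub>R u = x + s *\<^sub>R u + s *\<^sub>R v"
    by simp_all
  note eqs = this
  have "f (x + s *\<^sub>R u + s *\<^sub>R v) - f (x + s *\<^sub>R u) - f (x + s *\<^sub>R v) + f x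
      = s * s * partial j (partial i f) (x + a *\<^sub>R u + b *\<^sub>R v)"
    using a(3) b(3) unfolding eqs by (simp add: algebra_simps)
  with a b show ?thesis
    by (intro that[of a b]) (simp_all only: u_def v_def less_imp_le)
qed

text \<open>Both mixed derivatives, at suitable points of a small square, equal the same second
  difference divided by \<open>s * s\<close>. Continuity at \<open>x\<close> then excludes different
  values there.\<close>

lemma partial_commute_real:
  fixes f :: "real ^ 'n::finite \<Rightarrow> real"
  assumes "open U" "smooth_on U f" "x \<in> U"
  shows "partial i (partial j f) x = partial j (partial i f) x"
proof (rule ccontr)
  let ?P = "partial i (partial j f)" and ?Q = "partial j (partial i f)"
  assume ne: "?P x \<noteq> ?Q x"
  \<comment> \<open>Half the gap: two equal numbers cannot lie within \<open>e\<close> of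
    \<open>?P x\<close> and of \<open>?Q x\<close> respectively.\<close>
  define e where "e = \<bar>?P x - ?Q x\<bar> / 2"
  have e: "e > 0" using ne by (simp add: e_def)
  have cont: "isCont ?P x" "isCont ?Q x"
    using smooth_on_has_derivative[OF smooth_on_partial[OF smooth_on_partial[OF assms(2,1)] assms(1)] assms(1,3)]
      has_derivative_continuous by blast+
  obtain d1 where d1: "d1 > 0" "\<And>y. dist y x < d1 \<Longrightarrow> dist (?P y) (?P x) < e"
    using cont(1) e unfolding continuous_at_eps_delta by blast
  obtain d2 where d2: "d2 > 0" "\<And>y. dist y x < d2 \<Longrightarrow> dist (?Q y) (?Q x) < e"
    using cont(2) e unfolding continuous_at_eps_delta by blast
  obtain d3 where d3: "d3 > 0" "ball x d3 \<subseteq> U"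
    using assms(1,3) openE by blast
  \<comment> \<open>A corner of the square is at distance at most \<open>2 * s\<close> from
    \<open>x\<close>, so a third of each radius keeps the square strictly inside all three
    balls.\<close>
  define s where "s = min d1 (min d2 d3) / 3"
  have s: "s > 0" "3 * s \<le> d1" "3 * s \<le> d2" "3 * s \<le> d3"
    using d1 d2 d3 by (auto simp: s_def)
  have near: "dist (x + a *\<^sub>R axis k 1 + b *\<^sub>R axis l 1) x < 3 * s"
    if "0 \<le> a" "a \<le> s" "0 \<le> b" "b \<le> s" for a b and k l :: 'n
  proof -
    have "dist (x + a *\<^sub>R axis k 1 + b *\<^sub>R axis l 1) x = norm (a *\<^sub>R (axis k 1 :: real ^ 'n) + b *\<^sub>R axis l 1)"
      by (simp add: dist_norm)
    also have "\<dots> \<le> norm (a *\<^sub>R (axis k 1 :: real ^ 'n)) + norm (b *\<^sub>R (axis l 1 :: real ^ 'n))"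
      by (rule norm_triangle_ineq)
    also have "\<dots> < 3 * s" using that s by simp
    finally show ?thesis .
  qed
  have inU: "x + a *\<^sub>R axis k 1 + b *\<^sub>R axis l 1 \<in> U"
    if "0 \<le> a" "a \<le> s" "0 \<le> b" "b \<le> s" for a b and k l :: 'n
    using near[OF that, of k l] s d3 by (auto simp: dist_commute subset_iff)
  obtain a b where ab: "0 \<le> a" "a \<le> s" "0 \<le> b" "b \<le> s"
    "f (x + s *\<^sub>R axis i 1 + s *\<^sub>R axis j 1) - f (x + s *\<^sub>R axis i 1) - f (x + s *\<^sub>R axis j 1) + f x
      = s * s * ?Q (x + a *\<^sub>R axis i 1 + b *\<^sub>R axis j 1)"
    by (rule second_difference_mvt[OF assms(1,2) s(1), of x i j]) (use inU in blast)+
  obtain a' b' where ab': "0 \<le> a'" "a' \<le> s" "0 \<le> b'" "b' \<le> s"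
    "f (x + s *\<^sub>R axis j 1 + s *\<^sub>R axis i 1) - f (x + s *\<^sub>R axis j 1) - f (x + s *\<^sub>R axis i 1) + f x
      = s * s * ?P (x + a' *\<^sub>R axis j 1 + b' *\<^sub>R axis i 1)"
    by (rule second_difference_mvt[OF assms(1,2) s(1), of x j i]) (use inU in blast)+
  have "x + s *\<^sub>R axis j 1 + s *\<^sub>R axis i 1 = x + s *\<^sub>R axis i 1 + s *\<^sub>R axis j 1"
    by simp
  then have "s * s * ?P (x + a' *\<^sub>R axis j 1 + b' *\<^sub>R axis i 1)
      = s * s * ?Q (x + a *\<^sub>R axis i 1 + b *\<^sub>R axis j 1)"
    using ab(5) ab'(5) by (simp only:)
  then have "?P (x + a' *\<^sub>R axis j 1 + b' *\<^sub>R axis i 1) = ?Q (x + a *\<^sub>R axis i 1 + b *\<^sub>R axis j 1)"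
    using s by simp
  moreover have "dist (?P (x + a' *\<^sub>R axis j 1 + b' *\<^sub>R axis i 1)) (?P x) < e"
    using near[OF ab'(1-4), of j i] s by (intro d1) linarith
  moreover have "dist (?Q (x + a *\<^sub>R axis i 1 + b *\<^sub>R axis j 1)) (?Q x) < e"
    using near[OF ab(1-4), of i j] s by (intro d2) linarith
  ultimately show False
    by (auto simp: e_def dist_real_def abs_if split: if_splits)
qed

text \<open>Inner products with basis vectors reduce this to the real case. It is applied to the
  matrix-valued functions \<open>G\<close> and \<open>\<Gamma> c\<close>.\<close>

lemma partial_commute:
  fixes f :: "real ^ 'n::finite \<Rightarrow> 'b::euclidean_space"
  assumes "open U" "smooth_on U f" "x \<in> U"
  shows "partial i (partial j f) x = partial j (partial i f) x"
proof (rule euclidean_eqI)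
  fix b :: 'b assume "b \<in> Basis"
  let ?L = "\<lambda>y. y \<bullet> b"
  have L: "bounded_linear ?L" by (rule bounded_linear_inner_left)
  have 1: "partial k (\<lambda>y. ?L (f y)) y = ?L (partial k f y)" if "y \<in> U" for k y
    using partial_bounded_linear[OF L smooth_on_has_derivative[OF assms(2,1) that]] .
  have 2: "partial k (partial l (\<lambda>y. ?L (f y))) x = ?L (partial k (partial l f) x)" for k l
    by (rule trans[OF partial_cong_open[OF assms(1) 1 assms(3)] partial_bounded_linear[OF L smooth_on_has_derivative[OF smooth_on_partial[OF assms(2,1)] assms(1,3)]]])
  show "?L (partial i (partial j f) x) = ?L (partial j (partial i f) x)"
    unfolding 2[symmetric]
    by (rule partial_commute_real[OF assms(1) smooth_on_bounded_linear[OF assms(1) L assms(2)] assms(3)])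
qed

subsection \<open>Matrix-valued functions\<close>

lemma bounded_bilinear_matrix_mul:
  "bounded_bilinear ((**) :: real ^ 'n::finite ^ 'm::finite \<Rightarrow> real ^ 'k::finite ^ 'n \<Rightarrow> real ^ 'k ^ 'm)"
  unfolding bilinear_conv_bounded_bilinear[symmetric] bilinear_def linear_iff
  by (simp add: matrix_matrix_mult_def vec_eq_iff sum.distrib algebra_simps sum_distrib_left)

interpretation matrix_mul: bounded_bilinear "(**) :: real ^ 'n::finite ^ 'm::finite \<Rightarrow> real ^ 'k::finite ^ 'n \<Rightarrow> real ^ 'k ^ 'm"
  by (rule bounded_bilinear_matrix_mul)

lemma bounded_linear_transpose:
  "bounded_linear (transpose :: real ^ 'n::finite ^ 'm::finite \<Rightarrow> real ^ 'm ^ 'n)"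
  unfolding linear_conv_bounded_linear[symmetric] linear_iff
  by (simp add: transpose_def vec_eq_iff)

lemma transpose_add: "transpose (A + B) = transpose A + transpose (B :: real ^ 'n ^ 'm)"
  and transpose_diff: "transpose (A - B) = transpose A - transpose B"
  and transpose_minus: "transpose (- A) = - transpose A"
  by (simp_all add: transpose_def vec_eq_iff)

lemma transpose_sum: "transpose (\<Sum>i\<in>I. f i) = (\<Sum>i\<in>I. transpose (f i :: real ^ 'n::finite ^ 'm::finite))"
  by (simp add: transpose_def vec_eq_iff)

lemma trace_minus: "trace (- A) = - trace (A :: real ^ 'n::finite ^ 'n)"
  by (simp add: trace_def sum_negf)

section \<open>Inverses of matrix-valued functions and their derivatives\<close>

lemma matrix_inv_mul:
  fixes A :: "real ^ 'n::finite ^ 'n"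
  assumes "det A \<noteq> 0"
  shows "A ** matrix_inv A = mat 1" "matrix_inv A ** A = mat 1"
proof -
  have "\<exists>B. A ** B = mat 1 \<and> B ** A = mat 1"
    using assms by (simp add: invertible_det_nz[symmetric] invertible_def)
  then have "A ** matrix_inv A = mat 1 \<and> matrix_inv A ** A = mat 1"
    unfolding matrix_inv_def by (rule someI_ex)
  then show "A ** matrix_inv A = mat 1" "matrix_inv A ** A = mat 1" by auto
qed

text \<open>Cramer's rule for the equation whose solution is column \<open>j\<close> of the inverse.
  It exhibits every entry as a quotient of polynomials in the entries of \<open>A\<close>, which
  gives differentiability.\<close>

lemma matrix_inv_entry:
  fixes A :: "real ^ 'n::finite ^ 'n"
  assumes "det A \<noteq> 0"
  shows "matrix_inv A $ k $ j = det (\<chi> a b. if b = k then axis j 1 $ a else A $ a $ b) / det A"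
proof -
  have "A *v (matrix_inv A *v axis j 1) = axis j 1"
    using matrix_inv_mul[OF assms] by (simp add: matrix_vector_mul_assoc)
  then have "matrix_inv A *v axis j 1 = (\<chi> k. det (\<chi> a b. if b = k then axis j 1 $ a else A $ a $ b) / det A)"
    using cramer[OF assms] by blast
  moreover have "(matrix_inv A *v axis j 1) $ k = matrix_inv A $ k $ j"
    by (simp add: matrix_vector_mult_def axis_def if_distrib cong: if_cong)
  ultimately show ?thesis by simp
qed

lemma differentiable_det:
  fixes A :: "'a::real_normed_vector \<Rightarrow> real ^ 'n::finite ^ 'n"
  assumes "\<And>i j. (\<lambda>x. A x $ i $ j) differentiable at x"
  shows "(\<lambda>x. det (A x)) differentiable at x"
proof -
  have "(\<lambda>x. \<Prod>i\<in>UNIV. A x $ i $ p i) differentiable at x" for p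
    using has_derivative_prod[OF iffD1[OF frechet_derivative_works assms]]
    by (rule differentiableI)
  then show ?thesis
    unfolding det_def by (intro differentiable_sum differentiable_mult) auto
qed

lemma differentiable_vec:
  fixes f :: "'a::real_normed_vector \<Rightarrow> 'b::real_normed_vector ^ 'n::finite"
  assumes "\<And>i. (\<lambda>x. f x $ i) differentiable at x"
  shows "f differentiable at x"
proof -
  have "f = (\<lambda>x. \<Sum>i\<in>UNIV. axis i (f x $ i))"
    by (simp add: fun_eq_iff vec_eq_iff axis_def sum.delta)
  moreover have "(\<lambda>x. \<Sum>i\<in>UNIV. axis i (f x $ i)) differentiable at x"
    by (intro differentiable_sum ballI finite
        differentiableI[OF bounded_linear.has_derivative[OF bounded_linear_axis iffD1[OF frechet_derivative_works assms]]])
  ultimately show ?thesis by simp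
qed

lemma differentiable_matrix_inv:
  fixes A :: "'a::real_normed_vector \<Rightarrow> real ^ 'n::finite ^ 'n"
  assumes "open U" "\<And>x. x \<in> U \<Longrightarrow> det (A x) \<noteq> 0" "A differentiable at x" "x \<in> U"
  shows "(\<lambda>x. matrix_inv (A x)) differentiable at x"
proof (intro differentiable_vec)
  fix k j
  have D: "(\<lambda>x. A x $ a $ b) differentiable at x" for a b
    by (rule differentiableI[OF bounded_linear.has_derivative[OF bounded_linear_vec_nth
          bounded_linear.has_derivative[OF bounded_linear_vec_nth iffD1[OF frechet_derivative_works assms(3)]]]])
  have "(\<lambda>x. det (\<chi> a b. if b = k then axis j 1 $ a else A x $ a $ b) / det (A x)) differentiable at x"
  proof (intro differentiable_divide differentiable_det D assms)
    show "(\<lambda>x. (\<chi> a b. if b = k then axis j 1 $ a else A x $ a $ b) $ i $ l) differentiable at x" for i l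
      using D by (cases "l = k") auto
  qed
  then show "(\<lambda>x. matrix_inv (A x) $ k $ j) differentiable at x"
    using has_derivative_cong_open[OF assms(1) _ assms(4), of "\<lambda>x. matrix_inv (A x) $ k $ j"
       "\<lambda>x. det (\<chi> a b. if b = k then axis j 1 $ a else A x $ a $ b) / det (A x)"]
      matrix_inv_entry[OF assms(2)]
    unfolding differentiable_def by blast
qed

text \<open>Differentiating \<open>matrix_inv (G x) ** G x = mat 1\<close> and multiplying by the
  inverse on the right. The product rule applies because differentiability of the inverse is already
  known from Cramer's rule.\<close>

lemma partial_matrix_inv:
  fixes G :: "real ^ 'n::finite \<Rightarrow> real ^ 'm::finite ^ 'm"
  assumes "open U" "\<And>x. x \<in> U \<Longrightarrow> det (G x) \<noteq> 0" "(G has_derivative G') (at x)" "x \<in> U"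
  shows "partial i (\<lambda>x. matrix_inv (G x)) x = - (matrix_inv (G x) ** partial i G x ** matrix_inv (G x))"
proof -
  let ?H = "\<lambda>x. matrix_inv (G x)"
  have "?H differentiable at x"
    by (rule differentiable_matrix_inv[OF assms(1,2) differentiableI[OF assms(3)] assms(4)])
  then obtain H' where H': "(?H has_derivative H') (at x)"
    using differentiable_def by blast
  have "partial i (\<lambda>x. ?H x ** G x) x = partial i (\<lambda>x. mat 1) x"
    using matrix_inv_mul assms by (intro partial_cong_open[of U]) auto
  then have "?H x ** partial i G x + partial i ?H x ** G x = 0"
    using partial_bilinear[OF bounded_bilinear_matrix_mul H' assms(3)]
      partial_unique[OF has_derivative_const[of "mat 1 :: real ^ 'm ^ 'm" "at x"]]
    by simp
  then have "?H x ** partial i G x ** ?H x + partial i ?H x ** (G x ** ?H x) = 0"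
    by (metis matrix_mul.add_left matrix_mul.zero_left matrix_mul_assoc)
  then show ?thesis
    using matrix_inv_mul(1)[OF assms(2)[OF assms(4)]] by (simp add: eq_neg_iff_add_eq_0 add.commute)
qed

text \<open>Bootstrapping: the first partial derivatives are polynomial in the inverse and in
  derivatives of \<open>G\<close>, so class \<open>k\<close> of the inverse yields class
  \<open>Suc k\<close>.\<close>

lemma smooth_on_matrix_inv:
  fixes G :: "real ^ 'n::finite \<Rightarrow> real ^ 'm::finite ^ 'm"
  assumes "open U" "smooth_on U G" "\<And>x. x \<in> U \<Longrightarrow> det (G x) \<noteq> 0"
  shows "smooth_on U (\<lambda>x. matrix_inv (G x))"
proof -
  note DG = smooth_on_has_derivative[OF assms(2,1)]
  have diff: "(\<lambda>x. matrix_inv (G x)) differentiable at x" if "x \<in> U" for x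
    by (rule differentiable_matrix_inv[OF assms(1,3) differentiableI[OF DG[OF that]] that])
  have "Ck_on k U (\<lambda>x. matrix_inv (G x))" for k
  proof (induction k)
    case 0
    then show ?case
      using diff differentiable_imp_continuous_on[of "\<lambda>x. matrix_inv (G x)" U]
      by (simp add: differentiable_on_eq_differentiable_at assms(1))
  next
    case (Suc k)
    show ?case
    proof (rule Ck_on_SucI[OF assms(1)])
      show "((\<lambda>x. matrix_inv (G x)) has_derivative frechet_derivative (\<lambda>x. matrix_inv (G x)) (at x)) (at x)"
        if "x \<in> U" for x
        using diff[OF that] frechet_derivative_works by blast
      show "partial i (\<lambda>x. matrix_inv (G x)) x = - (matrix_inv (G x) ** partial i G x ** matrix_inv (G x))"
        if "x \<in> U" for x i
        by (rule partial_matrix_inv[OF assms(1,3) DG[OF that] that])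
      show "Ck_on k U (\<lambda>x. - (matrix_inv (G x) ** partial i G x ** matrix_inv (G x)))" for i
        using smooth_on_partial[OF assms(2,1), of i]
        by (intro Ck_on_bounded_linear[OF _ bounded_linear_minus[OF bounded_linear_ident]]
            Ck_on_bilinear[OF _ bounded_bilinear_matrix_mul] Suc.IH assms(1)) (simp add: smooth_on_def)
    qed
  qed
  then show ?thesis by (simp add: smooth_on_def)
qed

text \<open>These rules expand expressions in the matrix ring with transposition into sums of
  monomials, so that the identities below become additive cancellations.\<close>

lemmas matrix_ring_simps =
  matrix_mul_assoc matrix_mul.add_left matrix_mul.add_right matrix_mul.diff_left matrix_mul.diff_right
  matrix_mul.minus_left matrix_mul.minus_right transpose_add transpose_diff transpose_minus
  matrix_transpose_mul transpose_transpose

lemma partial_transpose: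
  fixes f :: "real ^ 'k::finite \<Rightarrow> real ^ 'n::finite ^ 'm::finite"
  shows "(f has_derivative f') (at x) \<Longrightarrow> partial i (\<lambda>y. transpose (f y)) x = transpose (partial i f x)"
  by (rule partial_bounded_linear[OF bounded_linear_transpose])

lemma bounded_linear_entry: "bounded_linear (\<lambda>A :: 'a::real_normed_vector ^ 'n::finite ^ 'm::finite. A $ a $ b)"
  using bounded_linear_compose[OF bounded_linear_vec_nth bounded_linear_vec_nth] .

lemmas partial_entry = partial_bounded_linear[OF bounded_linear_entry]

subsection \<open>Curvature identities in matrix form\<close>

text \<open>Row index up, column index down: \<open>\<Gamma> i\<close> acts on component vectors,
  and the covariant derivative of a vector field with components Y is
  \<open>\<partial>\<^sub>i Y + \<Gamma> i Y\<close>.\<close>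

definition christoffel_matrix ::
    "(real ^ 'n \<Rightarrow> real ^ 'n ^ 'n::finite) \<Rightarrow> 'n \<Rightarrow> real ^ 'n \<Rightarrow> real ^ 'n ^ 'n"
  where "christoffel_matrix G i x = (\<chi> l k. christoffel G l i k x)"

text \<open>The commutator of the operators \<open>\<partial>\<^sub>i + \<Gamma> i\<close> and
  \<open>\<partial>\<^sub>j + \<Gamma> j\<close>.\<close>

definition curvature_matrix ::
    "(real ^ 'n \<Rightarrow> real ^ 'n ^ 'n::finite) \<Rightarrow> 'n \<Rightarrow> 'n \<Rightarrow> real ^ 'n \<Rightarrow> real ^ 'n ^ 'n"
  where "curvature_matrix G i j x =
    partial i (christoffel_matrix G j) x - partial j (christoffel_matrix G i) x
    + christoffel_matrix G i x ** christoffel_matrix G j x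
    - christoffel_matrix G j x ** christoffel_matrix G i x"

text \<open>The components of \<nabla>R in direction \<open>m\<close>. The endomorphism indices
  contribute the commutator with the connection matrix, the form indices \<open>i\<close> and
  \<open>j\<close> the two sums.\<close>

definition cov_curvature_matrix ::
    "(real ^ 'n \<Rightarrow> real ^ 'n ^ 'n::finite) \<Rightarrow> 'n \<Rightarrow> 'n \<Rightarrow> 'n \<Rightarrow> real ^ 'n \<Rightarrow> real ^ 'n ^ 'n"
  where "cov_curvature_matrix G m i j x =
    partial m (curvature_matrix G i j) x
    + christoffel_matrix G m x ** curvature_matrix G i j x
    - curvature_matrix G i j x ** christoffel_matrix G m x
    - (\<Sum>a\<in>UNIV. christoffel G a m i x *\<^sub>R curvature_matrix G a j x)
    - (\<Sum>a\<in>UNIV. christoffel G a m j x *\<^sub>R curvature_matrix G i a x)"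

text \<open>\<open>U\<close> stands for the image of a chart and \<open>G\<close> for the metric in
  its coordinates. The conditions hold at all points of the open set, not at one point, so that
  identities derived from them can be differentiated.\<close>

locale coordinate_metric =
  fixes U :: "(real ^ 'n::finite) set" and G :: "real ^ 'n \<Rightarrow> real ^ 'n ^ 'n"
  assumes open_U: "open U"
    and smooth_G: "smooth_on U G"
    and symmetric_G: "x \<in> U \<Longrightarrow> transpose (G x) = G x"
    and det_G: "x \<in> U \<Longrightarrow> det (G x) \<noteq> 0"
begin

abbreviation "H \<equiv> \<lambda>x. matrix_inv (G x)"
abbreviation "\<Gamma> \<equiv> christoffel_matrix G"
abbreviation "R \<equiv> curvature_matrix G"

lemmas GH = matrix_inv_mul(1)[OF det_G]
lemmas HG = matrix_inv_mul(2)[OF det_G]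

lemma H_cancel:
  assumes "x \<in> U"
  shows "A ** G x ** H x = A" "A ** H x ** G x = A"
  using GH[OF assms] HG[OF assms] by (simp_all add: matrix_mul_assoc[symmetric])

lemma symmetric_H:
  assumes "x \<in> U"
  shows "transpose (H x) = H x"
proof -
  have "transpose (H x) = transpose (H x) ** G x ** H x"
    by (simp add: H_cancel assms)
  also have "transpose (H x) ** G x = transpose (G x ** H x)"
    by (simp add: matrix_transpose_mul symmetric_G assms)
  finally show ?thesis by (simp add: GH assms)
qed

lemma smooth_H: "smooth_on U H"
  by (rule smooth_on_matrix_inv[OF open_U smooth_G det_G])

lemma partial_G_entry:
  assumes "x \<in> U"
  shows "partial i (\<lambda>y. G y $ j $ l) x = partial i G x $ j $ l"
  using partial_nth[OF bounded_linear.has_derivative[OF bounded_linear_vec_nth smooth_on_has_derivative[OF smooth_G open_U assms]]]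
    partial_nth[OF smooth_on_has_derivative[OF smooth_G open_U assms]]
  by metis

lemma smooth_christoffel: "smooth_on U (christoffel G k i j)"
proof -
  have "smooth_on U (\<lambda>x. 1/2 * (\<Sum>l\<in>UNIV. H x $ k $ l *
      (partial i (\<lambda>y. G y $ j $ l) x + partial j (\<lambda>y. G y $ i $ l) x - partial l (\<lambda>y. G y $ i $ j) x)))"
    by (intro smooth_on_mult smooth_on_sum smooth_on_diff smooth_on_add smooth_on_partial
        smooth_on_const smooth_on_nth smooth_H smooth_G open_U)
  then show ?thesis by (simp add: christoffel_def[abs_def])
qed

lemma smooth_christoffel_matrix: "smooth_on U (\<Gamma> i)"
  unfolding christoffel_matrix_def[abs_def]
  by (intro smooth_on_vec_lambda smooth_christoffel open_U)

lemma smooth_curvature_matrix: "smooth_on U (R i j)"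
  unfolding curvature_matrix_def[abs_def]
  by (intro smooth_on_diff smooth_on_add smooth_on_partial smooth_on_bilinear[OF _ bounded_bilinear_matrix_mul]
      smooth_christoffel_matrix open_U)

lemmas deriv_G = smooth_on_has_derivative[OF smooth_G open_U]
lemmas deriv_H = smooth_on_has_derivative[OF smooth_H open_U]
lemmas deriv_christoffel_matrix = smooth_on_has_derivative[OF smooth_christoffel_matrix open_U]
lemmas deriv_curvature_matrix = smooth_on_has_derivative[OF smooth_curvature_matrix open_U]
lemmas deriv_partial_christoffel_matrix = smooth_on_has_derivative[OF smooth_on_partial[OF smooth_christoffel_matrix open_U] open_U]

lemma symmetric_partial_G:
  assumes "x \<in> U"
  shows "transpose (partial m G x) = partial m G x"
  by (rule trans[OF partial_transpose[OF deriv_G[OF assms], symmetric] partial_cong_open[OF open_U symmetric_G assms]])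

lemma symmetric_entries:
  assumes "x \<in> U"
  shows "G x $ i $ j = G x $ j $ i" "H x $ i $ j = H x $ j $ i" "partial m G x $ i $ j = partial m G x $ j $ i"
proof -
  have "A $ i $ j = A $ j $ i" if "transpose A = A" for A :: "real ^ 'n ^ 'n"
    using arg_cong[OF that, of "\<lambda>B. B $ j $ i"] by (simp add: transpose_def)
  then show "G x $ i $ j = G x $ j $ i" "H x $ i $ j = H x $ j $ i" "partial m G x $ i $ j = partial m G x $ j $ i"
    using symmetric_G[OF assms] symmetric_H[OF assms] symmetric_partial_G[OF assms] by blast+
qed

section \<open>The Levi-Civita connection and the algebraic symmetries of its curvature\<close>

lemma torsion_free:
  assumes "x \<in> U"
  shows "christoffel G k i j x = christoffel G k j i x"
  unfolding christoffel_def partial_G_entry[OF assms]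
  by (rule arg_cong[where f = "(*) (1/2)"], rule sum.cong)
     (auto simp: symmetric_entries(3)[OF assms, of _ i j])

lemma metric_compatible:
  assumes "x \<in> U"
  shows "partial m G x = G x ** \<Gamma> m x + transpose (\<Gamma> m x) ** G x"
proof -
  \<comment> \<open>The Christoffel symbols of the first kind; lowering the upper index of
    \<open>\<Gamma> m x\<close> by \<open>G x\<close> gives \<open>A\<close>.\<close>
  define A where "A = (\<chi> l j. 1/2 * (partial m G x $ j $ l + partial j G x $ m $ l - partial l G x $ m $ j))"
  have "\<Gamma> m x = H x ** A"
    by (simp add: vec_eq_iff christoffel_matrix_def christoffel_def matrix_matrix_mult_def A_def
        partial_G_entry[OF assms] sum_divide_distrib)
  then have GA: "G x ** \<Gamma> m x = A"
    by (simp add: matrix_mul_assoc GH[OF assms])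
  then have AT: "transpose (\<Gamma> m x) ** G x = transpose A"
    by (metis matrix_transpose_mul symmetric_G[OF assms])
  \<comment> \<open>The last two terms of \<open>A\<close> form a part skew in \<open>l\<close> and
    \<open>j\<close>, which the transpose cancels.\<close>
  have "partial m G x = A + transpose A"
    by (simp add: vec_eq_iff A_def transpose_def symmetric_entries(3)[OF assms, of m] field_simps)
  then show ?thesis by (simp add: GA AT)
qed

text \<open>The inverse metric is parallel: metric compatibility substituted into the derivative of
  the inverse.\<close>

lemma partial_H:
  assumes "x \<in> U"
  shows "partial m H x = - (\<Gamma> m x ** H x) - H x ** transpose (\<Gamma> m x)"
  using partial_matrix_inv[OF open_U det_G deriv_G[OF assms] assms, of m] metric_compatible[OF assms, of m]
  by (simp add: matrix_ring_simps H_cancel[OF assms] HG[OF assms])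

text \<open>The second derivatives of \<open>G\<close> commute. Expanding both orders by metric
  compatibility, the mixed terms of the shape
  \<open>transpose (\<Gamma> i x) ** G x ** \<Gamma> j x\<close> cancel, and what remains is this
  sum.\<close>

lemma lowered_curvature_skew:
  assumes "x \<in> U"
  shows "G x ** R i j x + transpose (R i j x) ** G x = 0"
proof -
  let ?D = "\<lambda>i j. partial i (\<Gamma> j) x"
  have "partial i (partial j G) x = G x ** ?D i j + partial i G x ** \<Gamma> j x
      + (transpose (\<Gamma> j x) ** partial i G x + transpose (?D i j) ** G x)" for i j
  proof -
    note D1 = matrix_mul.FDERIV[OF deriv_G deriv_christoffel_matrix, OF assms assms]
    note DT = bounded_linear.has_derivative[OF bounded_linear_transpose deriv_christoffel_matrix[OF assms]]
    note D2 = matrix_mul.FDERIV[OF DT deriv_G[OF assms]]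
    have "partial i (partial j G) x = partial i (\<lambda>y. G y ** \<Gamma> j y + transpose (\<Gamma> j y) ** G y) x"
      using metric_compatible by (intro partial_cong_open[OF open_U _ assms])
    also have "\<dots> = G x ** ?D i j + partial i G x ** \<Gamma> j x
      + (transpose (\<Gamma> j x) ** partial i G x + transpose (?D i j) ** G x)"
      using partial_unique[OF has_derivative_add[OF D1 D2]] by (simp add: partial_def)
    finally show ?thesis .
  qed
  from this[of i j] this[of j i] partial_commute[OF open_U smooth_G assms, of i j]
  have "G x ** ?D i j + partial i G x ** \<Gamma> j x
      + (transpose (\<Gamma> j x) ** partial i G x + transpose (?D i j) ** G x)
    - (G x ** ?D j i + partial j G x ** \<Gamma> i x
      + (transpose (\<Gamma> i x) ** partial j G x + transpose (?D j i) ** G x)) = 0"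
    by simp
  then show ?thesis
    unfolding metric_compatible[OF assms] curvature_matrix_def
    by (simp add: matrix_ring_simps algebra_simps)
qed

lemma raised_curvature_skew:
  assumes "x \<in> U"
  shows "R i j x ** H x + H x ** transpose (R i j x) = 0"
proof -
  have "H x ** (G x ** R i j x + transpose (R i j x) ** G x) ** H x = 0"
    by (simp add: lowered_curvature_skew[OF assms])
  then show ?thesis by (simp add: matrix_ring_simps H_cancel[OF assms] HG[OF assms])
qed

lemma curvature_antisym: "R j i x = - R i j x"
  by (simp add: curvature_matrix_def)

text \<open>\<open>R i j x ** H x\<close> is skew and \<open>G x\<close> is symmetric, so the trace
  of their product vanishes.\<close>

lemma trace_curvature:
  assumes "x \<in> U"
  shows "trace (R i j x) = 0"
proof -
  have "trace (R i j x) = trace (R i j x ** H x ** G x)"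
    by (simp add: H_cancel[OF assms])
  also have "R i j x ** H x = - (H x ** transpose (R i j x))"
    using raised_curvature_skew[OF assms] by (simp add: eq_neg_iff_add_eq_0)
  also have "trace (- (H x ** transpose (R i j x)) ** G x) = - trace (G x ** (H x ** transpose (R i j x)))"
    using trace_mul_sym[of "H x ** transpose (R i j x)" "G x"]
    by (simp only: matrix_mul.minus_left trace_minus)
  also have "\<dots> = - trace (R i j x)"
    by (simp add: matrix_mul_assoc GH[OF assms]) (simp add: trace_def transpose_def)
  finally show ?thesis by simp
qed

lemma partial_christoffel:
  assumes "x \<in> U"
  shows "partial i (christoffel G l j k) x = partial i (\<Gamma> j) x $ l $ k"
  using partial_entry[OF deriv_christoffel_matrix[OF assms], of i j l k] by (simp add: christoffel_matrix_def)

lemma riemann_eq: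
  assumes "x \<in> U"
  shows "riemann G l k i j x = R i j x $ l $ k"
  by (simp add: riemann_def curvature_matrix_def partial_christoffel[OF assms] sum_subtractf
      matrix_matrix_mult_def) (simp add: christoffel_matrix_def)

text \<open>After an exchange of the lower indices of the inner Christoffel symbol, derivative terms
  and quadratic terms cancel in pairs around the cycle.\<close>

lemma first_bianchi:
  assumes "x \<in> U"
  shows "R i j x $ l $ k + R j k x $ l $ i + R k i x $ l $ j = 0"
proof -
  have 1: "partial a (christoffel G l b c) x = partial a (christoffel G l c b) x" for a b c
    using torsion_free by (intro partial_cong_open[OF open_U _ assms])
  have 2: "(\<Sum>m\<in>UNIV. christoffel G l a m x * christoffel G m b c x) =
      (\<Sum>m\<in>UNIV. christoffel G l a m x * christoffel G m c b x)" for a b c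
    by (simp add: torsion_free[OF assms, of _ b c])
  show ?thesis
    unfolding riemann_eq[OF assms, symmetric] riemann_def sum_subtractf
    using 1[of i j k] 1[of j k i] 1[of k i j] 2[of i j k] 2[of j k i] 2[of k i j]
    by simp
qed

lemma ricci_eq:
  assumes "x \<in> U"
  shows "ricci G j k x = (\<Sum>i\<in>UNIV. R i j x $ i $ k)"
  by (simp add: ricci_def riemann_eq[OF assms])

text \<open>Contracting \<open>l\<close> with \<open>i\<close> in the first Bianchi identity leaves
  the two Ricci entries with opposite signs and a trace of the curvature, which is zero.\<close>

lemma ricci_symmetric:
  assumes "x \<in> U"
  shows "ricci G j k x = ricci G k j x"
proof -
  have "(\<Sum>i\<in>UNIV. R i j x $ i $ k + R j k x $ i $ i + R k i x $ i $ j) = 0"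
    by (simp add: first_bianchi[OF assms])
  moreover have "(\<Sum>i\<in>UNIV. R j k x $ i $ i) = 0"
    using trace_curvature[OF assms] by (simp add: trace_def)
  moreover have "(\<Sum>i\<in>UNIV. R k i x $ i $ j) = - (\<Sum>i\<in>UNIV. R i k x $ i $ j)"
    by (simp add: curvature_antisym[of k] sum_negf)
  ultimately show ?thesis
    by (simp add: ricci_eq[OF assms] sum.distrib)
qed

section \<open>The second Bianchi identity and the covariant derivative of the curvature\<close>

lemma partial_curvature_matrix:
  assumes "x \<in> U"
  shows "partial m (R i j) x = partial m (partial i (\<Gamma> j)) x - partial m (partial j (\<Gamma> i)) x
    + (\<Gamma> i x ** partial m (\<Gamma> j) x + partial m (\<Gamma> i) x ** \<Gamma> j x)
    - (\<Gamma> j x ** partial m (\<Gamma> i) x + partial m (\<Gamma> j) x ** \<Gamma> i x)"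
proof -
  note D1 = matrix_mul.FDERIV[OF deriv_christoffel_matrix deriv_christoffel_matrix, OF assms assms]
  note D2 = has_derivative_diff[OF has_derivative_add[OF has_derivative_diff[OF deriv_partial_christoffel_matrix deriv_partial_christoffel_matrix,
      OF assms assms] D1] D1]
  show ?thesis
    unfolding curvature_matrix_def[abs_def] by (subst partial_unique[OF D2]) (simp add: partial_def)
qed

text \<open>Two separate cancellations. The cyclic sum of \<open>?D\<close> vanishes by commuting
  partial derivatives and the Jacobi identity; the corrections for the form indices cancel by
  torsion-freeness and antisymmetry of the curvature.\<close>

lemma second_bianchi:
  assumes "x \<in> U"
  shows "cov_curvature_matrix G m i j x + cov_curvature_matrix G i j m x + cov_curvature_matrix G j m i x = 0"
proof -
  let ?D = "\<lambda>m i j. partial m (R i j) x + \<Gamma> m x ** R i j x - R i j x ** \<Gamma> m x"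
  have comm: "partial a (partial b (\<Gamma> c)) x = partial b (partial a (\<Gamma> c)) x" for a b c
    by (rule partial_commute[OF open_U smooth_christoffel_matrix assms])
  have D: "?D m i j + ?D i j m + ?D j m i = 0"
    unfolding partial_curvature_matrix[OF assms] curvature_matrix_def comm[of i m] comm[of j m] comm[of j i]
    by (simp add: matrix_ring_simps algebra_simps)
  let ?P = "\<lambda>k l b. \<Sum>a\<in>UNIV. christoffel G a k l x *\<^sub>R R a b x"
  let ?Q = "\<lambda>k l b. \<Sum>a\<in>UNIV. christoffel G a k l x *\<^sub>R R b a x"
  have cancel: "d1 + a - b + (d2 + c - a) + (d3 + b - c) = d1 + d2 + d3" for a b c d1 d2 d3 :: "real ^ 'n ^ 'n"
    by (simp add: algebra_simps)
  have T: "?P k l b = - ?Q l k b" for k l b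
    by (simp add: torsion_free[OF assms, of _ l k] curvature_antisym[of b] sum_negf)
  have "cov_curvature_matrix G k a b x = ?D k a b + ?Q a k b - ?Q k b a" for k a b
    unfolding cov_curvature_matrix_def T by simp
  then have "cov_curvature_matrix G m i j x + cov_curvature_matrix G i j m x + cov_curvature_matrix G j m i x
      = ?D m i j + ?D i j m + ?D j m i"
    by (simp only: cancel)
  then show ?thesis using D by (simp only:)
qed

text \<open>Since \<open>H\<close> is parallel, the skewness of \<open>R i j x ** H x\<close>
  survives covariant differentiation.\<close>

lemma cov_curvature_raised_skew:
  assumes "x \<in> U"
  shows "cov_curvature_matrix G m i j x ** H x + H x ** transpose (cov_curvature_matrix G m i j x) = 0"
proof -
  note skew = raised_curvature_skew[OF assms]
  note DT = bounded_linear.has_derivative[OF bounded_linear_transpose deriv_curvature_matrix[OF assms, of i j]]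
  note D = has_derivative_add[OF matrix_mul.FDERIV[OF deriv_curvature_matrix[OF assms, of i j] deriv_H[OF assms]]
      matrix_mul.FDERIV[OF deriv_H[OF assms] DT]]
  have "partial m (\<lambda>y. R i j y ** H y + H y ** transpose (R i j y)) x = partial m (\<lambda>y. 0) x"
    using raised_curvature_skew by (intro partial_cong_open[OF open_U _ assms])
  then have 1: "R i j x ** partial m H x + partial m (R i j) x ** H x
      + (H x ** transpose (partial m (R i j) x) + partial m H x ** transpose (R i j x)) = 0"
    unfolding partial_unique[OF D] partial_unique[OF has_derivative_const] by (simp add: partial_def)
  \<comment> \<open>Expanding \<open>partial m H x\<close> in fact \<open>1\<close> leaves stray
    terms such as \<open>\<Gamma> m x ** H x ** transpose (R i j x)\<close>. These two multiples of
    the skewness remove them and supply the missing halves of the commutators.\<close>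
  have 2: "\<Gamma> m x ** (R i j x ** H x + H x ** transpose (R i j x)) = 0"
    "(R i j x ** H x + H x ** transpose (R i j x)) ** transpose (\<Gamma> m x) = 0"
    by (simp_all add: skew)
  have 3: "(\<Sum>a\<in>UNIV. c a *\<^sub>R F a) ** H x + H x ** transpose (\<Sum>a\<in>UNIV. c a *\<^sub>R F a) = 0"
    if "\<And>a. F a ** H x + H x ** transpose (F a) = 0" for c and F :: "'n \<Rightarrow> real ^ 'n ^ 'n"
  proof -
    have "(\<Sum>a\<in>UNIV. c a *\<^sub>R F a) ** H x + H x ** transpose (\<Sum>a\<in>UNIV. c a *\<^sub>R F a)
        = (\<Sum>a\<in>UNIV. c a *\<^sub>R (F a ** H x + H x ** transpose (F a)))"
      by (simp add: transpose_sum matrix_mul.sum_left matrix_mul.sum_right transpose_scalar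
          matrix_mul.scaleR_left matrix_mul.scaleR_right scaleR_add_right sum.distrib)
    then show ?thesis by (simp add: that)
  qed
  have "cov_curvature_matrix G m i j x ** H x + H x ** transpose (cov_curvature_matrix G m i j x) =
      (R i j x ** partial m H x + partial m (R i j) x ** H x
        + (H x ** transpose (partial m (R i j) x) + partial m H x ** transpose (R i j x)))
      + \<Gamma> m x ** (R i j x ** H x + H x ** transpose (R i j x))
      + (R i j x ** H x + H x ** transpose (R i j x)) ** transpose (\<Gamma> m x)
      - ((\<Sum>a\<in>UNIV. christoffel G a m i x *\<^sub>R R a j x) ** H x
        + H x ** transpose (\<Sum>a\<in>UNIV. christoffel G a m i x *\<^sub>R R a j x))
      - ((\<Sum>a\<in>UNIV. christoffel G a m j x *\<^sub>R R i a x) ** H x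
        + H x ** transpose (\<Sum>a\<in>UNIV. christoffel G a m j x *\<^sub>R R i a x))"
    unfolding cov_curvature_matrix_def partial_H[OF assms]
    by (simp add: matrix_ring_simps algebra_simps)
  also have "\<dots> = 0"
    by (simp only: 1 2 3[OF skew]) simp
  finally show ?thesis .
qed

lemma cov_curvature_antisym:
  assumes "x \<in> U"
  shows "cov_curvature_matrix G m j i x = - cov_curvature_matrix G m i j x"
proof -
  have "partial m (R j i) x = - partial m (R i j) x"
    unfolding partial_curvature_matrix[OF assms] by (simp add: algebra_simps)
  moreover have "(\<Sum>a\<in>UNIV. c a *\<^sub>R R a b x) = - (\<Sum>a\<in>UNIV. c a *\<^sub>R R b a x)" for b and c :: "'n \<Rightarrow> real"
    by (simp add: curvature_antisym[of b] sum_negf)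
  ultimately show ?thesis
    unfolding cov_curvature_matrix_def curvature_antisym[of j i]
    by (simp add: matrix_mul.minus_left matrix_mul.minus_right)
qed

text \<open>Covariant differentiation commutes with contraction: the connection terms of the
  contracted upper index and of the contracted form index cancel, which is fact
  \<open>4\<close>.\<close>

lemma cov_deriv_ricci_eq:
  assumes "x \<in> U"
  shows "cov_deriv G (ricci G) m j k x = (\<Sum>i\<in>UNIV. cov_curvature_matrix G m i j x $ i $ k)"
proof -
  note D = bounded_linear.has_derivative[OF bounded_linear_entry deriv_curvature_matrix[OF assms]]
  have "partial m (ricci G j k) x = partial m (\<lambda>y. \<Sum>i\<in>UNIV. R i j y $ i $ k) x"
    using ricci_eq by (intro partial_cong_open[OF open_U _ assms])
  also have "\<dots> = (\<Sum>i\<in>UNIV. partial m (R i j) x $ i $ k)"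
    by (simp add: partial_sum[OF D] partial_entry[OF deriv_curvature_matrix[OF assms]])
  finally have 1: "partial m (ricci G j k) x = (\<Sum>i\<in>UNIV. partial m (R i j) x $ i $ k)" .
  have 2: "(\<Sum>i\<in>UNIV. (\<Sum>a\<in>UNIV. christoffel G a m j x * R i a x $ i $ k))
      = (\<Sum>a\<in>UNIV. christoffel G a m j x * ricci G a k x)"
    by (subst sum.swap) (simp add: ricci_eq[OF assms] sum_distrib_left)
  have 3: "(\<Sum>i\<in>UNIV. (R i j x ** \<Gamma> m x) $ i $ k) = (\<Sum>a\<in>UNIV. christoffel G a m k x * ricci G j a x)"
    unfolding matrix_matrix_mult_def
    by (simp add: ricci_eq[OF assms] sum_distrib_left christoffel_matrix_def mult.commute)
       (rule sum.swap)
  have 4: "(\<Sum>i\<in>UNIV. (\<Sum>a\<in>UNIV. christoffel G a m i x * R a j x $ i $ k))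
      = (\<Sum>i\<in>UNIV. (\<Gamma> m x ** R i j x) $ i $ k)"
    unfolding matrix_matrix_mult_def by (subst sum.swap) (simp add: christoffel_matrix_def)
  show ?thesis
    unfolding cov_deriv_def cov_curvature_matrix_def
    using 2 3 4 by (simp add: sum.distrib sum_subtractf 1)
qed

lemma cov_deriv_ricci_symmetric:
  assumes "x \<in> U"
  shows "cov_deriv G (ricci G) m j k x = cov_deriv G (ricci G) m k j x"
proof -
  have "partial m (ricci G j k) x = partial m (ricci G k j) x"
    using ricci_symmetric by (intro partial_cong_open[OF open_U _ assms])
  then show ?thesis
    unfolding cov_deriv_def by (simp add: ricci_symmetric[OF assms, of _ k] ricci_symmetric[OF assms, of j])
qed

text \<open>Contracting the second Bianchi identity twice; the skewness of the curvature turns the last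
  of its three terms into a second copy of the divergence.\<close>

lemma contracted_bianchi:
  assumes "x \<in> U"
  shows "2 * (\<Sum>m\<in>UNIV. \<Sum>k\<in>UNIV. H x $ m $ k * cov_deriv G (ricci G) m j k x)
    = (\<Sum>m\<in>UNIV. \<Sum>k\<in>UNIV. H x $ m $ k * cov_deriv G (ricci G) j m k x)"
proof -
  let ?B = "\<lambda>m i j. cov_curvature_matrix G m i j x" and ?D = "\<lambda>m j k. cov_deriv G (ricci G) m j k x"
  \<comment> \<open>The second Bianchi identity contracted in \<open>i\<close>; reversing the form
    indices of its third term accounts for the minus sign.\<close>
  have "?D m j k + (\<Sum>i\<in>UNIV. ?B i j m $ i $ k) - ?D j m k = 0" for m k
  proof -
    have "(\<Sum>i\<in>UNIV. (?B m i j + ?B i j m + ?B j m i) $ i $ k) = 0"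
      by (simp only: second_bianchi[OF assms]) simp
    then show ?thesis
      by (simp add: sum.distrib cov_deriv_ricci_eq[OF assms] cov_curvature_antisym[OF assms, of j m] sum_negf sum_subtractf)
  qed
  then have "(\<Sum>m\<in>UNIV. \<Sum>k\<in>UNIV. H x $ m $ k * (?D m j k + (\<Sum>i\<in>UNIV. ?B i j m $ i $ k) - ?D j m k)) = 0"
    by simp
  moreover have "(\<Sum>m\<in>UNIV. \<Sum>k\<in>UNIV. H x $ m $ k * (\<Sum>i\<in>UNIV. ?B i j m $ i $ k))
      = (\<Sum>m\<in>UNIV. \<Sum>k\<in>UNIV. H x $ m $ k * ?D m j k)"
  proof -
    have skew: "(?B i a b ** H x) $ c $ d = - (?B i a b ** H x) $ d $ c" for i a b c d
    proof -
      have "(H x ** transpose (?B i a b)) $ c $ d = (?B i a b ** H x) $ d $ c"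
        using symmetric_entries(2)[OF assms]
        by (simp add: matrix_matrix_mult_def transpose_def mult.commute)
      moreover have "(?B i a b ** H x) $ c $ d + (H x ** transpose (?B i a b)) $ c $ d = 0"
        using arg_cong[OF cov_curvature_raised_skew[OF assms, of i a b], of "\<lambda>A. A $ c $ d"] by simp
      ultimately show ?thesis by simp
    qed
    have "(\<Sum>m\<in>UNIV. \<Sum>k\<in>UNIV. H x $ m $ k * (\<Sum>i\<in>UNIV. ?B i j m $ i $ k))
        = (\<Sum>m\<in>UNIV. \<Sum>i\<in>UNIV. \<Sum>k\<in>UNIV. ?B i j m $ i $ k * H x $ k $ m)"
      unfolding sum_distrib_left
      by (rule sum.cong[OF refl], subst sum.swap)
         (simp add: symmetric_entries(2)[OF assms] mult.commute)
    also have "\<dots> = (\<Sum>m\<in>UNIV. \<Sum>i\<in>UNIV. (?B i j m ** H x) $ i $ m)"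
      by (simp add: matrix_matrix_mult_def)
    also have "\<dots> = (\<Sum>m\<in>UNIV. \<Sum>i\<in>UNIV. (?B i m j ** H x) $ m $ i)"
    proof -
      \<comment> \<open>Two signs cancel: one from the skew raised pair, one from the antisymmetric
        form indices. Afterwards the contraction over \<open>m\<close> is the one that defines
        Ricci.\<close>
      have "(?B i j m ** H x) $ i $ m = (?B i m j ** H x) $ m $ i" for i m
        using skew[of i j m i m] cov_curvature_antisym[OF assms, of i j m] by (simp add: matrix_mul.minus_left)
      then show ?thesis by simp
    qed
    also have "\<dots> = (\<Sum>i\<in>UNIV. \<Sum>m\<in>UNIV. \<Sum>k\<in>UNIV. ?B i m j $ m $ k * H x $ k $ i)"
      by (subst sum.swap) (simp add: matrix_matrix_mult_def)
    also have "\<dots> = (\<Sum>i\<in>UNIV. \<Sum>k\<in>UNIV. H x $ i $ k * ?D i j k)"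
      unfolding cov_deriv_ricci_eq[OF assms] sum_distrib_left
      by (rule sum.cong[OF refl], subst sum.swap)
         (simp add: symmetric_entries(2)[OF assms] mult.commute)
    finally show ?thesis .
  qed
  ultimately show ?thesis
    by (simp add: algebra_simps sum.distrib sum_subtractf)
qed

section \<open>The differential of the scalar curvature\<close>

lemma smooth_ricci: "smooth_on U (ricci G j k)"
proof (rule smooth_on_cong[OF open_U])
  show "smooth_on U (\<lambda>x. \<Sum>i\<in>UNIV. R i j x $ i $ k)"
    by (intro smooth_on_sum smooth_on_nth smooth_curvature_matrix open_U)
qed (simp add: ricci_eq)

lemma smooth_scalar_curvature: "smooth_on U (scalar_curvature G)"
  unfolding scalar_curvature_def[abs_def]
  by (intro smooth_on_sum smooth_on_mult smooth_on_nth smooth_H smooth_ricci open_U)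

text \<open>In the product rule for the trace of Ricci, the derivative of \<open>H\<close> produces
  exactly the Christoffel corrections in the covariant derivative of Ricci.\<close>

lemma partial_scalar_curvature:
  assumes "x \<in> U"
  shows "partial m (scalar_curvature G) x = (\<Sum>j\<in>UNIV. \<Sum>k\<in>UNIV. H x $ j $ k * cov_deriv G (ricci G) m j k x)"
proof -
  note D_ricci = smooth_on_has_derivative[OF smooth_ricci open_U assms]
  note D_H = bounded_linear.has_derivative[OF bounded_linear_entry deriv_H[OF assms]]
  note D1 = bounded_bilinear.FDERIV[OF bounded_bilinear_mult D_H D_ricci]
  note D2 = has_derivative_sum[OF D1]
  have "scalar_curvature G = (\<lambda>x. \<Sum>j\<in>UNIV. \<Sum>k\<in>UNIV. H x $ j $ k * ricci G j k x)"
    by (simp add: scalar_curvature_def[abs_def])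
  then have 1: "partial m (scalar_curvature G) x = (\<Sum>j\<in>UNIV. \<Sum>k\<in>UNIV.
      H x $ j $ k * partial m (ricci G j k) x + partial m H x $ j $ k * ricci G j k x)"
    by (simp only: partial_sum[OF D2] partial_sum[OF D1] partial_bilinear[OF bounded_bilinear_mult D_H D_ricci]
      partial_entry[OF deriv_H[OF assms]])
  have 2: "(\<Sum>j\<in>UNIV. \<Sum>k\<in>UNIV. (\<Gamma> m x ** H x) $ j $ k * ricci G j k x)
    = (\<Sum>j\<in>UNIV. \<Sum>k\<in>UNIV. H x $ j $ k * (\<Sum>a\<in>UNIV. christoffel G a m j x * ricci G a k x))"
    proof -
    have "(\<Sum>j\<in>UNIV. \<Sum>k\<in>UNIV. (\<Gamma> m x ** H x) $ j $ k * ricci G j k x)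
        = (\<Sum>j\<in>UNIV. \<Sum>k\<in>UNIV. \<Sum>a\<in>UNIV. H x $ a $ k * (christoffel G j m a x * ricci G j k x))"
      by (simp add: matrix_matrix_mult_def christoffel_matrix_def sum_distrib_left sum_distrib_right mult_ac)
    also have "\<dots> = (\<Sum>j\<in>UNIV. \<Sum>a\<in>UNIV. \<Sum>k\<in>UNIV. H x $ a $ k * (christoffel G j m a x * ricci G j k x))"
      by (rule sum.cong[OF refl], rule sum.swap)
    also have "\<dots> = (\<Sum>a\<in>UNIV. \<Sum>j\<in>UNIV. \<Sum>k\<in>UNIV. H x $ a $ k * (christoffel G j m a x * ricci G j k x))"
      by (rule sum.swap)
    also have "\<dots> = (\<Sum>a\<in>UNIV. \<Sum>k\<in>UNIV. \<Sum>j\<in>UNIV. H x $ a $ k * (christoffel G j m a x * ricci G j k x))"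
      by (rule sum.cong[OF refl], rule sum.swap)
    finally show ?thesis by (simp add: sum_distrib_left)
  qed
  have 3: "(\<Sum>j\<in>UNIV. \<Sum>k\<in>UNIV. (H x ** transpose (\<Gamma> m x)) $ j $ k * ricci G j k x)
    = (\<Sum>j\<in>UNIV. \<Sum>k\<in>UNIV. H x $ j $ k * (\<Sum>a\<in>UNIV. christoffel G a m k x * ricci G j a x))"
    proof (rule sum.cong[OF refl])
    fix j
    have "(\<Sum>k\<in>UNIV. (H x ** transpose (\<Gamma> m x)) $ j $ k * ricci G j k x)
        = (\<Sum>k\<in>UNIV. \<Sum>a\<in>UNIV. H x $ j $ a * (christoffel G k m a x * ricci G j k x))"
      by (simp add: matrix_matrix_mult_def transpose_def christoffel_matrix_def sum_distrib_left sum_distrib_right mult_ac)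
    also have "\<dots> = (\<Sum>a\<in>UNIV. \<Sum>k\<in>UNIV. H x $ j $ a * (christoffel G k m a x * ricci G j k x))"
      by (rule sum.swap)
    finally show "(\<Sum>k\<in>UNIV. (H x ** transpose (\<Gamma> m x)) $ j $ k * ricci G j k x)
        = (\<Sum>k\<in>UNIV. H x $ j $ k * (\<Sum>a\<in>UNIV. christoffel G a m k x * ricci G j a x))"
      by (simp add: sum_distrib_left)
  qed
  show ?thesis
    unfolding 1 cov_deriv_def partial_H[OF assms] using 2 3
    by (simp add: algebra_simps sum.distrib sum_subtractf sum_negf)
qed

end

subsection \<open>The Cotton--York tensor\<close>

locale coordinate_metric_3 = coordinate_metric U G for U :: "(real ^ 3) set" and G
begin

text \<open>The metric is parallel (\<open>e3\<close>), so the trace part of Schouten contributes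
  only the differential of the scalar curvature.\<close>

lemma cov_deriv_schouten_eq:
  assumes "x \<in> U"
  shows "cov_deriv G (schouten G) m j k x
    = cov_deriv G (ricci G) m j k x - partial m (scalar_curvature G) x / 4 * G x $ j $ k"
  proof -
  note D_ricci = smooth_on_has_derivative[OF smooth_ricci open_U assms]
  note D_s = smooth_on_has_derivative[OF smooth_on_mult[OF open_U smooth_scalar_curvature
      smooth_on_const[of _ "1/4"]] open_U assms]
  note D_s' = smooth_on_has_derivative[OF smooth_scalar_curvature open_U assms]
  note D_G = bounded_linear.has_derivative[OF bounded_linear_entry deriv_G[OF assms]]
  have e1: "partial m (schouten G j k) x = partial m (ricci G j k) x
      - (scalar_curvature G x * (1/4) * partial m G x $ j $ k + partial m (\<lambda>x. scalar_curvature G x * (1/4)) x * G x $ j $ k)"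
  proof -
    have "schouten G j k = (\<lambda>x. ricci G j k x - scalar_curvature G x * (1/4) * G x $ j $ k)"
      by (simp add: schouten_def[abs_def])
    then show ?thesis
      using partial_diff[OF D_ricci bounded_bilinear.FDERIV[OF bounded_bilinear_mult D_s D_G], of m j k j k]
      by (simp only: partial_bilinear[OF bounded_bilinear_mult D_s D_G] partial_entry[OF deriv_G[OF assms]])
  qed
  have e2: "partial m (\<lambda>x. scalar_curvature G x * (1/4)) x = partial m (scalar_curvature G) x / 4"
    using partial_bounded_linear[OF bounded_linear_mult_left D_s', of m "1/4"] by simp
  have e3: "partial m G x $ j $ k = (\<Sum>a\<in>UNIV. christoffel G a m j x * G x $ a $ k)
      + (\<Sum>a\<in>UNIV. christoffel G a m k x * G x $ j $ a)"
    unfolding metric_compatible[OF assms]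
    by (simp add: matrix_matrix_mult_def transpose_def christoffel_matrix_def mult.commute)
  show ?thesis
    unfolding cov_deriv_def e1 e2 e3 schouten_def
    by (simp add: algebra_simps sum_subtractf sum_distrib_left sum.distrib sum_divide_distrib)
qed

lemma cotton_antisym: "cotton G j i k x = - cotton G i j k x"
  by (simp add: cotton_def)

lemma cotton_cyclic:
  assumes "x \<in> U"
  shows "cotton G i j k x + cotton G j k i x + cotton G k i j x = 0"
proof -
  have "cov_deriv G (schouten G) a b c x = cov_deriv G (schouten G) a c b x" for a b c
    unfolding cov_deriv_schouten_eq[OF assms]
    by (simp only: cov_deriv_ricci_symmetric[OF assms, of a b c] symmetric_entries(1)[OF assms, of b c])
  from this[of i j k] this[of j i k] this[of k i j] show ?thesis
    unfolding cotton_def by linarith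
qed

text \<open>With ds the differential of the scalar curvature, the four contributions are ds/2 - ds -
  ds/4 + 3 ds/4 = 0. The first is the contracted Bianchi identity, the 3 is the dimension, and the
  coefficient 1/4 in Schouten is what balances the sum.\<close>

lemma cotton_trace:
  assumes "x \<in> U"
  shows "(\<Sum>m\<in>UNIV. \<Sum>k\<in>UNIV. H x $ m $ k * cotton G m j k x) = 0"
proof -
  let ?ds = "\<lambda>m. partial m (scalar_curvature G) x"
  have 1: "(\<Sum>k\<in>UNIV. H x $ m $ k * G x $ j $ k) = (if m = j then 1 else 0)" for m j
    using arg_cong[OF HG[OF assms], of "\<lambda>A. A $ m $ j"] symmetric_entries(1)[OF assms, of j]
    by (simp add: matrix_matrix_mult_def mat_def)
  have 2: "(\<Sum>m\<in>UNIV. \<Sum>k\<in>UNIV. H x $ m $ k * (?ds m * G x $ j $ k)) = ?ds j"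
  proof -
    have "(\<Sum>m\<in>UNIV. \<Sum>k\<in>UNIV. H x $ m $ k * (?ds m * G x $ j $ k))
        = (\<Sum>m\<in>UNIV. ?ds m * (\<Sum>k\<in>UNIV. H x $ m $ k * G x $ j $ k))"
      by (simp add: sum_distrib_left mult_ac)
    then show ?thesis by (simp add: 1 if_distrib cong: if_cong)
  qed
  have 3: "(\<Sum>m\<in>UNIV. \<Sum>k\<in>UNIV. H x $ m $ k * (?ds j * G x $ m $ k)) = 3 * ?ds j"
  proof -
    have "(\<Sum>m\<in>UNIV. \<Sum>k\<in>UNIV. H x $ m $ k * (?ds j * G x $ m $ k))
        = (\<Sum>m\<in>(UNIV :: 3 set). ?ds j * (\<Sum>k\<in>UNIV. H x $ m $ k * G x $ m $ k))"
      by (simp add: sum_distrib_left mult_ac)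
    then show ?thesis by (simp add: 1)
  qed
  have "(\<Sum>m\<in>UNIV. \<Sum>k\<in>UNIV. H x $ m $ k * cotton G m j k x)
     = (\<Sum>m\<in>UNIV. \<Sum>k\<in>UNIV. H x $ m $ k * cov_deriv G (ricci G) m j k x)
       - (\<Sum>m\<in>UNIV. \<Sum>k\<in>UNIV. H x $ m $ k * cov_deriv G (ricci G) j m k x)
       - (\<Sum>m\<in>UNIV. \<Sum>k\<in>UNIV. H x $ m $ k * (?ds m * G x $ j $ k)) / 4
       + (\<Sum>m\<in>UNIV. \<Sum>k\<in>UNIV. H x $ m $ k * (?ds j * G x $ m $ k)) / 4"
    unfolding cotton_def cov_deriv_schouten_eq[OF assms]
    by (simp add: algebra_simps sum.distrib sum_subtractf sum_divide_distrib)
  then show ?thesis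
    using contracted_bianchi[OF assms, of j] partial_scalar_curvature[OF assms, of j] 2 3 by simp
qed

text \<open>The dual of Cotton in its antisymmetric pair: column \<open>m\<close> holds the
  component with (k, l, m) a cyclic permutation of (1, 2, 3). The factor 1/2 in Cotton-York absorbs
  the two orders of k and l.\<close>

definition cotton_dual :: "real ^ 3 \<Rightarrow> real ^ 3 ^ 3"
  where "cotton_dual x = (\<chi> i m. if m = 1 then cotton G 2 3 i x else if m = 2 then cotton G 3 1 i x else cotton G 1 2 i x)"

lemma cotton_york_coords_eq:
  "cotton_york_coords G i j x = (cotton_dual x ** transpose (G x)) $ i $ j / sqrt (det (G x))"
proof -
  have C: "cotton G 2 1 i x = - cotton G 1 2 i x" "cotton G 1 3 i x = - cotton G 3 1 i x"
    "cotton G 3 2 i x = - cotton G 2 3 i x"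
    by (rule cotton_antisym)+
  show ?thesis
    unfolding cotton_york_coords_def sum_3
    by (simp add: levi_civita_def cotton_dual_def matrix_matrix_mult_def sum_3 transpose_def C add_divide_distrib)
qed

text \<open>\<open>G x\<close> and \<open>H x\<close> cancel, and the trace of the dual that remains
  is the cyclic sum of Cotton.\<close>

lemma cotton_york_trace:
  assumes "x \<in> U"
  shows "(\<Sum>i\<in>UNIV. \<Sum>j\<in>UNIV. H x $ i $ j * cotton_york_coords G i j x) = 0"
proof -
  let ?D = "cotton_dual x"
  have "(\<Sum>i\<in>UNIV. \<Sum>j\<in>UNIV. H x $ i $ j * cotton_york_coords G i j x)
      = trace (?D ** G x ** H x) / sqrt (det (G x))"
    unfolding cotton_york_coords_eq symmetric_G[OF assms] trace_def matrix_matrix_mult_def[of _ "H x"]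
    by (simp add: sum_divide_distrib symmetric_entries(2)[OF assms, of _ "_ :: 3"] mult.commute)
  also have "trace (?D ** G x ** H x) = cotton G 2 3 1 x + cotton G 3 1 2 x + cotton G 1 2 3 x"
    by (simp add: H_cancel[OF assms] trace_def sum_3 cotton_dual_def)
  finally show ?thesis
    using cotton_cyclic[OF assms, of 1 2 3] by simp
qed

text \<open>\<open>?D ** G x\<close> is congruent, through \<open>G x\<close>, to
  \<open>H x ** ?D\<close>, whose symmetry is the trace condition in disguise.\<close>

lemma cotton_york_symmetric:
  assumes "x \<in> U"
  shows "cotton_york_coords G i j x = cotton_york_coords G j i x"
proof -
  let ?D = "cotton_dual x"
  have C0: "cotton G a a b x = 0" for a b
    using cotton_antisym[of a a b x] by simp
  have C: "cotton G 2 1 i x = - cotton G 1 2 i x" "cotton G 1 3 i x = - cotton G 3 1 i x"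
    "cotton G 3 2 i x = - cotton G 2 3 i x" for i
    by (rule cotton_antisym)+
  \<comment> \<open>The difference of entries (1, 2) and (2, 1) is, up to sign, the trace identity
    with free index 3; the other two pairs go likewise.\<close>
  have "transpose (H x ** ?D) = H x ** ?D"
    using cotton_trace[OF assms, of 1] cotton_trace[OF assms, of 2] cotton_trace[OF assms, of 3]
    by (simp add: vec_eq_iff forall_3 transpose_def matrix_matrix_mult_def sum_3 cotton_dual_def C0 C)
  moreover have "?D ** G x = G x ** (H x ** ?D) ** G x"
    by (simp add: matrix_mul_assoc GH[OF assms])
  ultimately have "transpose (?D ** G x) = ?D ** G x"
    by (metis matrix_transpose_mul matrix_mul_assoc symmetric_G[OF assms])
  from arg_cong[OF this, of "\<lambda>A. A $ j $ i"] show ?thesis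
    unfolding cotton_york_coords_eq symmetric_G[OF assms] by (simp add: transpose_def)
qed

end

subsection \<open>Symmetric forms on a three-dimensional Euclidean space\<close>

definition pos_def :: "real ^ 'n::finite ^ 'n \<Rightarrow> bool"
  where "pos_def G \<longleftrightarrow> (\<forall>a. a \<noteq> 0 \<longrightarrow> a \<bullet> (G *v a) > 0)"

lemma det_zero_iff_kernel:
  fixes K :: "real ^ 'n::finite ^ 'n"
  shows "det K = 0 \<longleftrightarrow> (\<exists>x. x \<noteq> 0 \<and> K *v x = 0)"
  using invertible_det_nz[of K] invertible_left_inverse[of K] matrix_left_invertible_ker[of K] by blast

lemma pos_def_det: "pos_def G \<Longrightarrow> det G \<noteq> 0"
  unfolding pos_def_def det_zero_iff_kernel by (metis inner_zero_right less_irrefl)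

lemma inner_symmetric_matrix:
  fixes K :: "real ^ 'n::finite ^ 'n"
  assumes "transpose K = K"
  shows "u \<bullet> (K *v v) = v \<bullet> (K *v u)"
  by (metis assms dot_lmul_matrix inner_commute transpose_matrix_vector)

text \<open>Two vectors span at most a plane in \<real>^3.\<close>

lemma common_orthogonal_vector:
  fixes a b :: "real ^ 3"
  obtains w where "w \<noteq> 0" "w \<bullet> a = 0" "w \<bullet> b = 0"
proof -
  have "dim {a, b} \<le> card {a, b}" by (intro dim_le_card') simp
  also have "\<dots> < DIM(real ^ 3)" by (simp add: card_insert_if)
  finally obtain w where "w \<noteq> 0" "\<And>y. y \<in> span {a, b} \<Longrightarrow> orthogonal w y"
    using orthogonal_to_subspace_exists by blast
  then show ?thesis by (intro that) (auto simp: orthogonal_def span_base)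
qed

lemma det_zero_if_isotropic:
  fixes G K :: "real ^ 3 ^ 3"
  assumes G: "pos_def G" and v: "v \<noteq> 0" "v \<bullet> (K *v v) = 0"
    and perp: "\<And>w1 w2. v \<bullet> (G *v w1) = 0 \<Longrightarrow> v \<bullet> (G *v w2) = 0 \<Longrightarrow> w1 \<bullet> (K *v w2) = 0"
  shows "det K = 0"
proof -
  obtain w where w: "w \<noteq> 0" "w \<bullet> (transpose G *v v) = 0" "w \<bullet> (transpose K *v v) = 0"
    by (rule common_orthogonal_vector)
  have w': "v \<bullet> (G *v w) = 0" "v \<bullet> (K *v w) = 0"
    using w(2,3) by (metis dot_lmul_matrix inner_commute transpose_matrix_vector)+
  have "u \<bullet> (K *v w) = 0" for u
  proof -
    \<comment> \<open>The coefficient of the orthogonal projection of \<open>u\<close> onto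
      \<open>v\<close>: what is left of \<open>u\<close> lies in the complement of \<open>v\<close>,
      where \<open>perp\<close> applies, and the multiple of \<open>v\<close> is handled by the
      choice of \<open>w\<close>.\<close>
    define t where "t = (v \<bullet> (G *v u)) / (v \<bullet> (G *v v))"
    have "v \<bullet> (G *v v) > 0" using G v by (simp add: pos_def_def)
    then have "v \<bullet> (G *v (u - t *\<^sub>R v)) = 0"
      by (simp add: t_def matrix_vector_mult_diff_distrib inner_diff_right matrix_vector_mult_scaleR)
    then have "(u - t *\<^sub>R v) \<bullet> (K *v w) = 0" by (rule perp[OF _ w'(1)])
    then show ?thesis using w'(2) by (simp add: inner_diff_left)
  qed
  then have "K *v w = 0" by (metis inner_eq_zero_iff)
  then show ?thesis using w(1) det_zero_iff_kernel by blast
qed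

lemma pos_def_normalize:
  assumes "pos_def G" "x \<noteq> 0"
  obtains c where "c \<noteq> 0" "(c *\<^sub>R x) \<bullet> (G *v (c *\<^sub>R x)) = 1"
proof
  have "x \<bullet> (G *v x) > 0" using assms by (simp add: pos_def_def)
  then show "1 / sqrt (x \<bullet> (G *v x)) \<noteq> 0"
    "((1 / sqrt (x \<bullet> (G *v x))) *\<^sub>R x) \<bullet> (G *v ((1 / sqrt (x \<bullet> (G *v x))) *\<^sub>R x)) = 1"
    by (auto simp: matrix_vector_mult_scaleR power2_eq_square[symmetric])
qed

lemma isotropic_if_det_zero:
  fixes G K :: "real ^ 3 ^ 3"
  assumes G: "transpose G = G" "pos_def G" and K: "transpose K = K" "det K = 0"
    and trace: "trace (matrix_inv G ** K) = 0"
  shows "\<exists>v. v \<noteq> 0 \<and> v \<bullet> (K *v v) = 0 \<and>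
    (\<forall>w1 w2. v \<bullet> (G *v w1) = 0 \<longrightarrow> v \<bullet> (G *v w2) = 0 \<longrightarrow> w1 \<bullet> (K *v w2) = 0)"
proof -
  let ?g = "\<lambda>x y. x \<bullet> (G *v y)" and ?k = "\<lambda>x y. x \<bullet> (K *v y)"
  note gsym = inner_symmetric_matrix[OF G(1)] and ksym = inner_symmetric_matrix[OF K(1)]
  note lin = inner_add_left inner_add_right matrix_vector_right_distrib matrix_vector_mult_scaleR
  obtain u0 where u0: "u0 \<noteq> 0" "K *v u0 = 0" using K(2) det_zero_iff_kernel by blast
  obtain e0 where e0: "e0 \<noteq> 0" "e0 \<bullet> (G *v u0) = 0"
    using common_orthogonal_vector by metis
  obtain f0 where f0: "f0 \<noteq> 0" "f0 \<bullet> (G *v u0) = 0" "f0 \<bullet> (G *v e0) = 0"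
    using common_orthogonal_vector by metis
  obtain cu where cu: "cu \<noteq> 0" "?g (cu *\<^sub>R u0) (cu *\<^sub>R u0) = 1" using pos_def_normalize[OF G(2) u0(1)] .
  obtain ce where ce: "ce \<noteq> 0" "?g (ce *\<^sub>R e0) (ce *\<^sub>R e0) = 1" using pos_def_normalize[OF G(2) e0(1)] .
  obtain cf where cf: "cf \<noteq> 0" "?g (cf *\<^sub>R f0) (cf *\<^sub>R f0) = 1" using pos_def_normalize[OF G(2) f0(1)] .
  define u e f where "u = cu *\<^sub>R u0" and "e = ce *\<^sub>R e0" and "f = cf *\<^sub>R f0"
  have Ku: "K *v u = 0" using u0 by (simp add: u_def matrix_vector_mult_scaleR)
  have g: "?g u u = 1" "?g e e = 1" "?g f f = 1" "?g e u = 0" "?g f u = 0" "?g f e = 0"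
    using cu ce cf e0 f0 by (simp_all add: u_def e_def f_def matrix_vector_mult_scaleR)
  have g': "?g u e = 0" "?g u f = 0" "?g e f = 0"
    using g gsym by metis+
  \<comment> \<open>The rows are a \<open>G\<close>-orthonormal basis whose first vector is in the
    kernel of \<open>K\<close>; \<open>Q ** A ** transpose Q\<close> is then the matrix of the form
    \<open>A\<close> in that basis.\<close>
  define Q :: "real ^ 3 ^ 3" where "Q = vector [u, e, f]"
  have Qrow: "Q $ 1 = u" "Q $ 2 = e" "Q $ 3 = f" by (simp_all add: Q_def)
  have form: "(Q ** A ** transpose Q) $ i $ j = Q $ i \<bullet> (A *v Q $ j)" for A i j
  proof -
    have "(Q ** A ** transpose Q) $ i $ j = (Q ** (A ** transpose Q)) $ i $ j"
      by (simp add: matrix_mul_assoc)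
    then show ?thesis
      by (simp add: matrix_matrix_mult_def matrix_vector_mult_def inner_vec_def transpose_def)
  qed
  have "Q ** G ** transpose Q = mat 1"
    by (simp add: vec_eq_iff form forall_3 Qrow g g' mat_def)
  then have "Q ** (G ** transpose Q) = mat 1" by (simp add: matrix_mul_assoc)
  then have GQQ: "G ** transpose Q ** Q = mat 1" by (simp add: matrix_left_right_inverse)
  \<comment> \<open>Hence the metric trace of \<open>K\<close> is the ordinary trace of its matrix
    in the orthonormal basis.\<close>
  then have H: "matrix_inv G = transpose Q ** Q"
    by (metis G(2) matrix_inv_mul(2) matrix_mul_assoc matrix_mul_lid matrix_mul_rid pos_def_det)
  have "trace (Q ** K ** transpose Q) = trace (matrix_inv G ** K)"
    unfolding H using trace_mul_sym[of "Q ** K" "transpose Q"] by (simp add: matrix_mul_assoc)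
  then have tr: "?k u u + ?k e e + ?k f f = 0"
    using trace by (simp add: trace_def sum_3 form Qrow)
  define \<alpha> \<beta> where "\<alpha> = ?k e e" and "\<beta> = ?k e f"
  have k: "?k e e = \<alpha>" "?k f f = - \<alpha>" "?k e f = \<beta>" "?k f e = \<beta>"
    using tr Ku ksym by (auto simp: \<alpha>_def \<beta>_def)
  \<comment> \<open>An isotropic vector of the plane with matrix rows (\<alpha>, \<beta>) and
    (\<beta>, -\<alpha>); the determinant is not positive, so a real solution exists.\<close>
  obtain s t where st: "\<alpha> * s\<^sup>2 + 2 * \<beta> * s * t - \<alpha> * t\<^sup>2 = 0" "s\<^sup>2 + t\<^sup>2 \<noteq> 0"
  proof (cases "\<alpha> = 0")
    case True
    then show ?thesis by (intro that[of 1 0]) auto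
  next
    case False
    \<comment> \<open>Setting t = \<alpha> and dividing by \<alpha> leaves s^2 + 2 \<beta> s =
      \<alpha>^2, of which this is a root.\<close>
    let ?s = "sqrt (\<beta>\<^sup>2 + \<alpha>\<^sup>2) - \<beta>"
    have "?s\<^sup>2 + 2 * \<beta> * ?s = \<alpha>\<^sup>2" by (simp add: power2_diff algebra_simps power2_eq_square[of \<beta>])
    then have "\<alpha> * (?s\<^sup>2 + 2 * \<beta> * ?s - \<alpha>\<^sup>2) = 0" by simp
    then have "\<alpha> * ?s\<^sup>2 + 2 * \<beta> * ?s * \<alpha> - \<alpha> * \<alpha>\<^sup>2 = 0" by (simp only: algebra_simps)
    moreover have "?s\<^sup>2 + \<alpha>\<^sup>2 \<noteq> 0" using False by (simp only: sum_power2_eq_zero_iff) simp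
    ultimately show ?thesis by (rule that)
  qed
  \<comment> \<open>\<open>w\<close> is \<open>v\<close> turned by a right angle, which changes the
    sign of a trace-free form on the plane.\<close>
  define v w where "v = s *\<^sub>R e + t *\<^sub>R f" and "w = (- t) *\<^sub>R e + s *\<^sub>R f"
  have kv: "?k v v = 0" and kw: "?k w w = 0"
    using st(1) by (simp_all add: v_def w_def lin k algebra_simps power2_eq_square)
  have gv: "?g v x = s * ?g e x + t * ?g f x" for x
    by (simp add: v_def lin)
  have "?g v v = s\<^sup>2 + t\<^sup>2"
    by (simp add: v_def lin g g' power2_eq_square)
  then have "v \<noteq> 0" using st(2) by auto
  have col: "transpose Q *v z = z $ 1 *\<^sub>R u + z $ 2 *\<^sub>R e + z $ 3 *\<^sub>R f" for z
    by (simp add: vec_eq_iff matrix_vector_mult_def transpose_def sum_3 Qrow mult.commute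
        del: transpose_matrix_vector)
  have perp: "\<exists>b c. x = b *\<^sub>R u + c *\<^sub>R w" if "?g v x = 0" for x
  proof -
    have "x = (transpose Q ** Q ** G) *v x"
      using matrix_inv_mul(2)[OF pos_def_det[OF G(2)]] H by simp
    also have "\<dots> = transpose Q *v (Q *v (G *v x))"
      by (simp add: matrix_vector_mul_assoc matrix_mul_assoc)
    also have "\<dots> = ?g u x *\<^sub>R u + ?g e x *\<^sub>R e + ?g f x *\<^sub>R f"
      by (simp only: col matrix_vector_mul_component Qrow)
    finally have x: "x = ?g u x *\<^sub>R u + ?g e x *\<^sub>R e + ?g f x *\<^sub>R f" .
    \<comment> \<open>The component of \<open>x\<close> along \<open>w\<close>, namely g(w, x) /
      g(w, w).\<close>
    define c where "c = (s * ?g f x - t * ?g e x) / (s\<^sup>2 + t\<^sup>2)"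
    have 0: "s * ?g e x + t * ?g f x = 0" using that gv by simp
    have "(s\<^sup>2 + t\<^sup>2) * ?g e x = (s\<^sup>2 + t\<^sup>2) * (c * - t)"
      using st(2) 0 unfolding c_def by simp algebra
    moreover have "(s\<^sup>2 + t\<^sup>2) * ?g f x = (s\<^sup>2 + t\<^sup>2) * (c * s)"
      using st(2) 0 unfolding c_def by simp algebra
    ultimately have "?g e x = c * - t" "?g f x = c * s"
      unfolding mult_left_cancel[OF st(2)] .
    then have "x = ?g u x *\<^sub>R u + c *\<^sub>R w"
      using x by (simp add: w_def algebra_simps)
    then show ?thesis by blast
  qed
  have "?k x y = 0" if xy: "?g v x = 0" "?g v y = 0" for x y
  proof -
    obtain b c b' c' where "x = b *\<^sub>R u + c *\<^sub>R w" "y = b' *\<^sub>R u + c' *\<^sub>R w"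
      using perp[OF xy(1)] perp[OF xy(2)] by blast
    moreover have "?k u w = 0" using ksym[of u w] Ku by simp
    ultimately show ?thesis by (simp add: lin Ku kw)
  qed
  with kv \<open>v \<noteq> 0\<close> show ?thesis by blast
qed


subsection \<open>Charts and tangent spaces\<close>

lemma chart_inv_apply:
  assumes "is_chart X c" "x \<in> fst c"
  shows "chart_inv c (snd c x) = x"
proof -
  have "inj_on (snd c) (topspace (subtopology X (fst c)))"
    using assms(1) by (auto simp: is_chart_def homeomorphic_map_def dest: homeomorphic_imp_injective_map)
  moreover have "topspace (subtopology X (fst c)) = fst c"
    using assms(1) openin_subset by (fastforce simp: is_chart_def)
  ultimately show ?thesis
    using assms(2) by (simp add: chart_inv_def)
qed

text \<open>Makes chart overlaps open in coordinates, so that transition maps have genuine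
  derivatives there.\<close>

lemma open_chart_image:
  assumes "is_chart X c" "openin X S" "S \<subseteq> fst c"
  shows "open (snd c ` S)"
proof -
  have "openin (subtopology X (fst c)) S"
    using assms by (metis inf.orderE openin_subtopology)
  then have "openin (top_of_set (snd c ` fst c)) (snd c ` S)"
    using assms(1) homeomorphic_imp_open_map unfolding is_chart_def open_map_def by blast
  then show ?thesis
    using assms(1) openin_open_trans by (auto simp: is_chart_def)
qed

locale manifold_point =
  fixes X :: "'m topology" and A :: "('m, 'n::finite) chart set" and p :: 'm
  assumes manifold: "smooth_manifold X A"
    and point: "p \<in> topspace X"
begin

lemma chart_at: "c \<in> charts_at A p \<Longrightarrow> is_chart X c"
  and in_atlas: "c \<in> charts_at A p \<Longrightarrow> c \<in> A"
  and in_domain: "c \<in> charts_at A p \<Longrightarrow> p \<in> fst c"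
  using manifold by (auto simp: smooth_manifold_def charts_at_def)

lemma openin_domain: "c \<in> charts_at A p \<Longrightarrow> openin X (fst c)"
  using chart_at by (simp add: is_chart_def)

lemma transition_has_derivative:
  assumes c: "c \<in> charts_at A p" and d: "d \<in> charts_at A p"
  shows "(transition c d has_derivative frechet_derivative (transition c d) (at (snd c p))) (at (snd c p))"
proof (rule smooth_on_has_derivative)
  show "smooth_on (snd c ` (fst c \<inter> fst d)) (transition c d)"
    using manifold in_atlas[OF c] in_atlas[OF d] by (simp add: smooth_manifold_def)
  show "open (snd c ` (fst c \<inter> fst d))"
    by (rule open_chart_image[OF chart_at[OF c]]) (auto intro: openin_Int openin_domain c d)
qed (use in_domain c d in auto)

lemma transition_apply: "c \<in> charts_at A p \<Longrightarrow> x \<in> fst c \<Longrightarrow> transition c d (snd c x) = snd d x"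
  by (simp add: transition_def chart_inv_apply[OF chart_at])

text \<open>The cocycle rule: the chain rule, combined with the agreement of the composite and the
  direct coordinate change on the image of the triple overlap. It makes coordinate vectors
  compatible across charts.\<close>

lemma transition_chain:
  assumes c: "c \<in> charts_at A p" and d: "d \<in> charts_at A p" and e: "e \<in> charts_at A p"
  shows "frechet_derivative (transition d e) (at (snd d p)) (frechet_derivative (transition c d) (at (snd c p)) a)
    = frechet_derivative (transition c e) (at (snd c p)) a"
proof -
  let ?S = "fst c \<inter> fst d \<inter> fst e"
  have S: "open (snd c ` ?S)"
    by (rule open_chart_image[OF chart_at[OF c]]) (auto intro!: openin_Int openin_domain c d e)
  have "transition c d (snd c p) = snd d p"
    using transition_apply c in_domain by blast
  then have "((\<lambda>y. transition d e (transition c d y)) has_derivative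
      (\<lambda>a. frechet_derivative (transition d e) (at (snd d p)) (frechet_derivative (transition c d) (at (snd c p)) a)))
      (at (snd c p))"
    using has_derivative_compose[OF transition_has_derivative[OF c d], of "transition d e"]
      transition_has_derivative[OF d e] by simp
  moreover have "transition d e (transition c d y) = transition c e y" if "y \<in> snd c ` ?S" for y
    using that by (auto simp: transition_apply c d)
  moreover have "snd c p \<in> snd c ` ?S" using in_domain c d e by blast
  ultimately have "(transition c e has_derivative
      (\<lambda>a. frechet_derivative (transition d e) (at (snd d p)) (frechet_derivative (transition c d) (at (snd c p)) a)))
      (at (snd c p))"
    using has_derivative_transform_within_open[OF _ S] by blast
  from frechet_derivative_at[OF this, THEN fun_cong, of a] show ?thesis by simp
qed

lemma transition_self:
  assumes c: "c \<in> charts_at A p"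
  shows "frechet_derivative (transition c c) (at (snd c p)) a = a"
proof -
  have S: "open (snd c ` fst c)"
    using chart_at[OF c] by (simp add: is_chart_def)
  have "y = transition c c y" if "y \<in> snd c ` fst c" for y
    using that by (auto simp: transition_apply c)
  moreover have "snd c p \<in> snd c ` fst c" using in_domain c by blast
  ultimately have "(transition c c has_derivative (\<lambda>a. a)) (at (snd c p))"
    using has_derivative_transform_within_open[OF has_derivative_ident S] by blast
  from frechet_derivative_at[OF this, THEN fun_cong, of a] show ?thesis by simp
qed

lemma coord_vector_in_tangent_space:
  assumes c: "c \<in> charts_at A p"
  shows "coord_vector A c p i \<in> tangent_space A p"
  by (auto simp: tangent_space_def coord_vector_def transition_chain[OF c])

lemma coord_vector_self: "c \<in> charts_at A p \<Longrightarrow> coord_vector A c p i c = axis i 1"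
  by (simp add: coord_vector_def transition_self)

lemma linear_transition:
  assumes "c \<in> charts_at A p" "d \<in> charts_at A p"
  shows "linear (frechet_derivative (transition c d) (at (snd c p)))"
  using transition_has_derivative[OF assms] has_derivative_linear by blast

lemma tangent_vector_transport:
  assumes "v \<in> tangent_space A p" "c \<in> charts_at A p" "d \<in> charts_at A p"
  shows "v d = frechet_derivative (transition c d) (at (snd c p)) (v c)"
  using assms unfolding tangent_space_def by blast

lemma tangent_vector_outside:
  assumes "v \<in> tangent_space A p" "c \<notin> charts_at A p"
  shows "v c = 0"
  using assms unfolding tangent_space_def by blast

lemma tangent_spaceI:
  assumes "\<And>c d. c \<in> charts_at A p \<Longrightarrow> d \<in> charts_at A p
      \<Longrightarrow> v d = frechet_derivative (transition c d) (at (snd c p)) (v c)"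
    and "\<And>c. c \<notin> charts_at A p \<Longrightarrow> v c = 0"
  shows "v \<in> tangent_space A p"
  using assms unfolding tangent_space_def by blast

section \<open>The tangent space as a copy of coordinate space\<close>

lemma subspace_tangent_space: "subspace (tangent_space A p)"
  unfolding subspace_def
proof (intro conjI ballI allI)
  show "0 \<in> tangent_space A p"
    by (intro tangent_spaceI) (simp_all add: linear_0[OF linear_transition])
  show "v + w \<in> tangent_space A p" if v: "v \<in> tangent_space A p" and w: "w \<in> tangent_space A p" for v w
  proof (rule tangent_spaceI)
    show "(v + w) d = frechet_derivative (transition c d) (at (snd c p)) ((v + w) c)"
      if "c \<in> charts_at A p" "d \<in> charts_at A p" for c d
      using tangent_vector_transport[OF v that] tangent_vector_transport[OF w that]
      by (simp add: linear_add[OF linear_transition[OF that]])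
  qed (simp add: tangent_vector_outside v w)
  show "r *\<^sub>R v \<in> tangent_space A p" if v: "v \<in> tangent_space A p" for r v
  proof (rule tangent_spaceI)
    show "(r *\<^sub>R v) d = frechet_derivative (transition c d) (at (snd c p)) ((r *\<^sub>R v) c)"
      if "c \<in> charts_at A p" "d \<in> charts_at A p" for c d
      using tangent_vector_transport[OF v that]
      by (simp add: scaleR_fun_def linear_cmul[OF linear_transition[OF that]])
  qed (simp add: tangent_vector_outside v scaleR_fun_def)
qed

text \<open>One chart determines a tangent vector: transport gives its components in the other
  charts at \<open>p\<close>, and elsewhere its value is fixed to 0.\<close>

lemma tangent_vector_eqI:
  assumes v: "v \<in> tangent_space A p" and w: "w \<in> tangent_space A p"
    and c: "c \<in> charts_at A p" and eq: "v c = w c"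
  shows "v = w"
proof
  show "v d = w d" for d
    using tangent_vector_transport[OF v c] tangent_vector_transport[OF w c]
      tangent_vector_outside[OF v] tangent_vector_outside[OF w] eq
    by (cases "d \<in> charts_at A p") simp_all
qed

lemma sum_scaleR_fun_apply: "(\<Sum>i\<in>I. r i *\<^sub>R f i) c = (\<Sum>i\<in>I. r i *\<^sub>R f i c)"
  for f :: "'i \<Rightarrow> 'x \<Rightarrow> 'b::real_vector"
  by (induction I rule: infinite_finite_induct) (auto simp: scaleR_fun_def)

text \<open>The inverse of the component map \<open>v \<mapsto> v c\<close> on the tangent
  space.\<close>

definition tangent_vector :: "('m, 'n) chart \<Rightarrow> real ^ 'n \<Rightarrow> ('m, 'n) tangent_vector"
  where "tangent_vector c a = (\<Sum>i\<in>UNIV. a $ i *\<^sub>R coord_vector A c p i)"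

lemma tangent_vector_in: "c \<in> charts_at A p \<Longrightarrow> tangent_vector c a \<in> tangent_space A p"
  unfolding tangent_vector_def
  by (intro subspace_sum subspace_scale subspace_tangent_space coord_vector_in_tangent_space)

lemma tangent_vector_self: "c \<in> charts_at A p \<Longrightarrow> tangent_vector c a c = a"
  by (simp add: tangent_vector_def sum_scaleR_fun_apply coord_vector_self vec_eq_iff axis_def
      if_distrib cong: if_cong)

lemma tangent_vector_eq:
  assumes "c \<in> charts_at A p" "v \<in> tangent_space A p"
  shows "tangent_vector c (v c) = v"
  by (rule tangent_vector_eqI[OF tangent_vector_in[OF assms(1)] assms(2,1)])
     (rule tangent_vector_self[OF assms(1)])

text \<open>A kernel vector of the transposed component matrix would be a nontrivial linear relation
  between the basis vectors.\<close>

lemma det_basis_components: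
  assumes c: "c \<in> charts_at A p" and b: "is_basis_of b (tangent_space A p)"
  shows "det (\<chi> i. b i c) \<noteq> 0"
proof
  assume "det (\<chi> i. b i c) = 0"
  then have "det (transpose (\<chi> i. b i c)) = 0" by (simp add: det_transpose)
  then obtain y where y: "y \<noteq> 0" "transpose (\<chi> i. b i c) *v y = 0"
    using det_zero_iff_kernel by blast
  define v where "v = (\<Sum>i\<in>UNIV. y $ i *\<^sub>R b i)"
  have bT: "b i \<in> tangent_space A p" for i
    using b span_base[of "b i" "range b"] by (auto simp: is_basis_of_def)
  have "v c = transpose (\<chi> i. b i c) *v y"
    by (simp add: v_def sum_scaleR_fun_apply vec_eq_iff matrix_vector_mult_def transpose_def mult.commute)
  then have "v c = 0" using y by simp
  moreover have "v \<in> tangent_space A p"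
    unfolding v_def by (intro subspace_sum subspace_scale subspace_tangent_space bT)
  ultimately have "v = 0"
    using tangent_vector_eqI[OF _ subspace_0[OF subspace_tangent_space] c] by simp
  \<comment> \<open>Linear independence concerns the set \<open>range b\<close>, so the sum is
    reindexed over it using injectivity of \<open>b\<close>.\<close>
  moreover have "v = (\<Sum>x\<in>range b. y $ (inv b x) *\<^sub>R x)"
    using b by (simp add: v_def is_basis_of_def sum.reindex)
  ultimately have "y $ (inv b x) = 0" if "x \<in> range b" for x
    using b that independentD[of "range b" "range b" "\<lambda>x. y $ (inv b x)"] by (auto simp: is_basis_of_def)
  then have "y $ i = 0" for i
    using b by (metis inv_f_f is_basis_of_def rangeI)
  then show False using y(1) by (simp add: vec_eq_iff)
qed

text \<open>\<open>inner_product_on\<close> gives linearity only inside \<open>T\<close>, so every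
  partial sum has to be kept in the subspace.\<close>

lemma inner_product_sum_left:
  assumes h: "inner_product_on T h" and T: "subspace T"
    and f: "\<And>i. f i \<in> T" and w: "w \<in> T"
  shows "h (\<Sum>i\<in>I. r i *\<^sub>R f i) w = (\<Sum>i\<in>I. r i * h (f i) w)"
proof -
  have 0: "h 0 w = 0"
  proof -
    have "h (0 *\<^sub>R w) w = 0 * h w w"
      using h w unfolding inner_product_on_def by blast
    then show ?thesis by simp
  qed
  show ?thesis
  proof (induction I rule: infinite_finite_induct)
    case (insert i I)
    have "h (r i *\<^sub>R f i + (\<Sum>i\<in>I. r i *\<^sub>R f i)) w = h (r i *\<^sub>R f i) w + h (\<Sum>i\<in>I. r i *\<^sub>R f i) w"
      using h w f T unfolding inner_product_on_def
      by (meson subspace_scale subspace_sum)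
    moreover have "h (r i *\<^sub>R f i) w = r i * h (f i) w"
      using h w f unfolding inner_product_on_def by blast
    ultimately show ?case using insert by simp
  qed (simp_all add: 0)
qed

lemma metric_coords_form:
  assumes c: "c \<in> charts_at A p" and h: "inner_product_on (tangent_space A p) (g p)"
    and v: "v \<in> tangent_space A p" and w: "w \<in> tangent_space A p"
  shows "g p v w = v c \<bullet> (metric_coords A g c (snd c p) *v w c)"
proof -
  let ?e = "coord_vector A c p"
  note e = coord_vector_in_tangent_space[OF c]
  have sym: "g p x y = g p y x" if "x \<in> tangent_space A p" "y \<in> tangent_space A p" for x y
    using h that by (simp add: inner_product_on_def)
  note left = inner_product_sum_left[OF h subspace_tangent_space e]
  have 1: "g p (?e i) w = (\<Sum>j\<in>UNIV. w c $ j * g p (?e i) (?e j))" for i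
  proof -
    have "g p (?e i) w = g p (tangent_vector c (w c)) (?e i)"
      using sym e w tangent_vector_eq[OF c w] by simp
    then show ?thesis
      by (simp add: tangent_vector_def left[OF e] sym[OF e e, of _ i])
  qed
  have "g p v w = g p (tangent_vector c (v c)) w"
    using tangent_vector_eq[OF c v] by simp
  also have "\<dots> = (\<Sum>i\<in>UNIV. v c $ i * g p (?e i) w)"
    by (simp add: tangent_vector_def left[OF w])
  finally show ?thesis
    by (simp add: 1 inner_vec_def matrix_vector_mult_def metric_coords_def
        chart_inv_apply[OF chart_at[OF c] in_domain[OF c]] mult.commute)
qed

lemma metric_coords_pos_def:
  assumes c: "c \<in> charts_at A p" and h: "inner_product_on (tangent_space A p) (g p)"
  shows "pos_def (metric_coords A g c (snd c p))"
  unfolding pos_def_def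
proof (intro allI impI)
  fix a :: "real ^ 'n" assume a: "a \<noteq> 0"
  let ?v = "tangent_vector c a"
  have "?v \<noteq> 0"
    using a tangent_vector_self[OF c, of a] by (metis zero_fun_apply)
  then have "g p ?v ?v > 0"
    using h tangent_vector_in[OF c] by (simp add: inner_product_on_def)
  then show "a \<bullet> (metric_coords A g c (snd c p) *v a) > 0"
    using metric_coords_form[where g = g, OF c h tangent_vector_in[OF c] tangent_vector_in[OF c]] tangent_vector_self[OF c]
    by simp
qed

lemma metric_coords_symmetric:
  assumes c: "c \<in> charts_at A p" and h: "inner_product_on (tangent_space A p) (g p)"
  shows "transpose (metric_coords A g c (snd c p)) = metric_coords A g c (snd c p)"
  using h coord_vector_in_tangent_space[OF c]
  by (simp add: vec_eq_iff transpose_def metric_coords_def inner_product_on_def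
      chart_inv_apply[OF chart_at[OF c] in_domain[OF c]])

end

text \<open>Differentiating the metric takes symmetry and nondegeneracy on the whole chart image;
  hence \<open>manifold_point\<close> is interpreted at the preimage \<open>q\<close> of each of its
  points.\<close>

lemma coordinate_metric_chart:
  assumes M: "riemannian_manifold X A g" and c: "c \<in> A"
  shows "coordinate_metric (snd c ` fst c) (metric_coords A g c)"
proof
  have man: "smooth_manifold X A"
    using M by (simp add: riemannian_manifold_def)
  then have chart: "is_chart X c" using c by (simp add: smooth_manifold_def)
  show "open (snd c ` fst c)" using chart by (simp add: is_chart_def)
  show "smooth_on (snd c ` fst c) (metric_coords A g c)"
    using M c by (simp add: riemannian_manifold_def)
  fix x assume "x \<in> snd c ` fst c"
  then obtain q where q: "q \<in> fst c" "x = snd c q" by blast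
  then have "q \<in> topspace X"
    using chart openin_subset by (fastforce simp: is_chart_def)
  then interpret manifold_point X A q
    using man by unfold_locales
  have cq: "c \<in> charts_at A q" using c q by (simp add: charts_at_def)
  have h: "inner_product_on (tangent_space A q) (g q)"
    using M \<open>q \<in> topspace X\<close> by (simp add: riemannian_manifold_def)
  show "transpose (metric_coords A g c x) = metric_coords A g c x"
    "det (metric_coords A g c x) \<noteq> 0"
    using metric_coords_symmetric[where g = g, OF cq h] pos_def_det[OF metric_coords_pos_def[where g = g, OF cq h]] q by simp_all
qed

theorem corollary1p7:
  fixes X :: "'m topology" and A :: "('m, 3) chart set" and g :: "('m, 3) metric_field"
    and p :: 'm and c :: "('m, 3) chart" and b :: "3 \<Rightarrow> ('m, 3) tangent_vector"
  assumes "riemannian_manifold X A g"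
    and "p \<in> topspace X"
    and "c \<in> charts_at A p"
    and "is_basis_of b (tangent_space A p)"
  shows "(\<exists>v\<in>tangent_space A p. v \<noteq> 0 \<and> cotton_york A g c p v v = 0 \<and>
            (\<forall>w1\<in>orthogonal_complement A g p v. \<forall>w2\<in>orthogonal_complement A g p v.
               cotton_york A g c p w1 w2 = 0))
         \<longleftrightarrow> det (\<chi> i j. cotton_york A g c p (b i) (b j)) = 0"
    (is "?isotropic \<longleftrightarrow> ?singular")
proof -
  note c = assms(3)
  interpret manifold_point X A p
    using assms(1,2) by unfold_locales (auto simp: riemannian_manifold_def)
  have h: "inner_product_on (tangent_space A p) (g p)"
    using assms(1,2) by (simp add: riemannian_manifold_def)
  define x where "x = snd c p"
  define G where "G = metric_coords A g c"
  interpret coordinate_metric_3 "snd c ` fst c" G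
    unfolding G_def coordinate_metric_3_def
    by (rule coordinate_metric_chart[OF assms(1) in_atlas[OF c]])
  have x: "x \<in> snd c ` fst c" using in_domain[OF c] by (simp add: x_def)
  define K :: "real ^ 3 ^ 3" where "K = (\<chi> i j. cotton_york_coords G i j x)"
  have K: "transpose K = K"
    using cotton_york_symmetric[OF x] by (simp add: K_def transpose_def vec_eq_iff)
  have "trace (matrix_inv (G x) ** K) = (\<Sum>i\<in>UNIV. \<Sum>j\<in>UNIV. matrix_inv (G x) $ i $ j * cotton_york_coords G j i x)"
    by (simp add: trace_def matrix_matrix_mult_def K_def)
  then have trace: "trace (matrix_inv (G x) ** K) = 0"
    using cotton_york_trace[OF x] cotton_york_symmetric[OF x] by simp
  have pd: "pos_def (G x)"
    using metric_coords_pos_def[where g = g, OF c h] by (simp add: G_def x_def)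
  have CY: "cotton_york A g c p v w = v c \<bullet> (K *v w c)" for v w
    by (simp add: cotton_york_def K_def G_def x_def inner_vec_def matrix_vector_mult_def sum_distrib_left mult_ac)
  have gp: "g p v w = v c \<bullet> (G x *v w c)" if "v \<in> tangent_space A p" "w \<in> tangent_space A p" for v w
    using metric_coords_form[where g = g, OF c h that] by (simp add: G_def x_def)
  \<comment> \<open>A change of basis multiplies the determinant by the square of the nonzero
    determinant of the components of \<open>b\<close>.\<close>
  have "?singular \<longleftrightarrow> det K = 0"
  proof -
    let ?B = "(\<chi> i. b i c) :: real ^ 3 ^ 3"
    have "(\<chi> i j. cotton_york A g c p (b i) (b j)) = ?B ** (K ** transpose ?B)"
      by (simp add: CY vec_eq_iff inner_vec_def matrix_vector_mult_def matrix_matrix_mult_def transpose_def)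
    then show ?thesis
      using det_basis_components[OF c assms(4)] by (simp add: det_mul)
  qed
  moreover have "?isotropic \<longleftrightarrow> det K = 0"
  proof
    assume ?isotropic
    then obtain v where v: "v \<in> tangent_space A p" "v \<noteq> 0" "v c \<bullet> (K *v v c) = 0"
      "\<And>w1 w2. w1 \<in> orthogonal_complement A g p v \<Longrightarrow> w2 \<in> orthogonal_complement A g p v
        \<Longrightarrow> w1 c \<bullet> (K *v w2 c) = 0"
      unfolding CY by blast
    show "det K = 0"
    proof (rule det_zero_if_isotropic[OF pd _ v(3)])
      show "v c \<noteq> 0"
        using v(1,2) tangent_vector_eqI[OF v(1) subspace_0[OF subspace_tangent_space] c] by auto
      \<comment> \<open>Vectors of \<real>^3 orthogonal to \<open>v c\<close> for \<open>G x\<close>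
        lift through \<open>tangent_vector c\<close> to the orthogonal complement of
        \<open>v\<close>.\<close>
      show "a1 \<bullet> (K *v a2) = 0" if "v c \<bullet> (G x *v a1) = 0" "v c \<bullet> (G x *v a2) = 0" for a1 a2
        using v(4)[of "tangent_vector c a1" "tangent_vector c a2"] that
        by (simp add: orthogonal_complement_def gp v(1) tangent_vector_in c tangent_vector_self)
    qed
  next
    assume "det K = 0"
    from isotropic_if_det_zero[OF symmetric_G[OF x] pd K this trace]
    obtain a where a: "a \<noteq> 0" "a \<bullet> (K *v a) = 0"
      "\<And>w1 w2. a \<bullet> (G x *v w1) = 0 \<Longrightarrow> a \<bullet> (G x *v w2) = 0 \<Longrightarrow> w1 \<bullet> (K *v w2) = 0" by blast
    show ?isotropic
    proof (intro bexI[of _ "tangent_vector c a"] conjI ballI)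
      show "tangent_vector c a \<noteq> 0"
        using a(1) tangent_vector_self[OF c, of a] by (metis zero_fun_apply)
      show "cotton_york A g c p w1 w2 = 0"
        if "w1 \<in> orthogonal_complement A g p (tangent_vector c a)"
          "w2 \<in> orthogonal_complement A g p (tangent_vector c a)" for w1 w2
        unfolding CY using that tangent_vector_in[OF c, of a]
        by (intro a(3)) (auto simp: orthogonal_complement_def gp tangent_vector_self c)
    qed (simp_all add: CY tangent_vector_self tangent_vector_in c a(2))
  qed
  ultimately show ?thesis by blast
qed

end
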